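(* Let $\mathcal{G}=(\mathcal{V},\mathcal{E})$ be a tree on $\mathcal{V}=\{0,\dots,n\}$ with line weights $B_{ik}=B_{ki}>0$, and let $w_1,\dots,w_n>0$ be arbitrary fixed weights. Let $\mathcal{S}\subseteq\mathbb{R}^n\times\mathbb{R}^n$ be the set of $(p,q)$ for which the optimization problem (R) of the context is feasible; for $(p,q)\in\mathcal{S}$ let $v(p,q)$ be the unique optimal solution of (R), and let $\theta(p,q)\in\mathbb{R}^{n+1}$ be the unique solution of $$\theta_i-\theta_k=\arcsin\left(\frac{s_{ik}(p)}{\sqrt{v_i(p,q)\,v_k(p,q)}}\right)\ \ \forall (i,k)\in\mathcal{E},\qquad \theta_0=0 .$$ Then the following statements hold: (i) $\mathcal{S}$ is a convex set and the map $(p,q)\mapsto(v(p,q),\theta(p,q))$ is continuous on $\mathcal{S}$; (ii) for any $(p,q)\notin\mathcal{S}$, there are no solutions to the power flow equations (PF); (iii) for any $(p,q)\in\mathcal{S}$, $(v(p,q),\theta(p,q))$ is the unique solution to the power flow equations that satisfies the following properties: - High-voltage: $v(p,q)\ge v'$ (componentwise) for every solution $v'$ of the reduced power flow equations (RPF); - Stability: $(v(p,q),\theta(p,q))$ lies in the domain of convexity of the energy function, i.e. it satisfies condition (C) of the context; - Voltage-regularity: the matrix $\frac{\partial v}{\partial q}$ is element-wise positive at the solution.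
   Context: Network. $\mathcal{G}=(\mathcal{V},\mathcal{E})$ is a tree with $\mathcal{V}=\{0,1,\dots,n\}$, rooted at bus $0$, edges oriented away from $0$; $\mathcal{N}(i)$ is the set of neighbours of $i$; $[n]=\{1,\dots,n\}$. Each edge has a weight $B_{ik}=B_{ki}>0$, and $\mathbf{B}_i=\sum_{k\in\mathcal{N}(i)}B_{ik}$. Bus $0$ has fixed squared voltage magnitude $v_0=1$ and phase $\theta_0=0$. All voltage vectors $v=(v_1,\dots,v_n)$ are required to be strictly positive. Flows. Given $p\in\mathbb{R}^n$, $s=s(p)$ denotes the unique solution, with $s_{ki}=-s_{ik}$, of the linear system $\sum_{k\in\mathcal{N}(i)}B_{ik}s_{ik}=p_i$, $i\in[n]$. Power flow equations (PF). Unknowns $v\in\mathbb{R}^n_{>0}$ and real $c_{ik}=c_{ki}$, $(i,k)\in\mathcal{E}$: $$\mathbf{B}_iv_i-\sum_{k\in\mathcal{N}(i)}B_{ik}c_{ik}=q_i\ \ \forall i\in[n],\qquad s_{ik}(p)^2+c_{ik}^2=v_iv_k\ \ \forall (i,k)\in\mathcal{E}.$$ Equivalently, a solution is a pair $(v,\theta)$ (phases modulo $2\pi$, $\theta_0=0$) such that $s_{ik}=\sqrt{v_iv_k}\sin(\theta_i-\theta_k)$ and $c_{ik}=\sqrt{v_iv_k}\cos(\theta_i-\theta_k)$ satisfy $\sum_{k\in\mathcal{N}(i)}B_{ik}s_{ik}=p_i$ and $\mathbf{B}_iv_i-\sum_{k\in\mathcal{N}(i)}B_{ik}c_{ik}=q_i$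 for all $i\in[n]$. Convention: any expression $\sqrt{v_iv_k-s_{ik}^2}$ implicitly requires $v_iv_k\ge s_{ik}^2$. Reduced power flow equations (RPF): $\mathbf{B}_iv_i-\sum_{k\in\mathcal{N}(i)}B_{ik}\sqrt{v_iv_k-s_{ik}(p)^2}=q_i$ for all $i\in[n]$, $v\in\mathbb{R}^n_{>0}$. Problem (R): $$\text{maximize}_{v\in\mathbb{R}^n_{>0}}\ \sum_{i=1}^nw_i\log v_i\quad\text{subject to}\quad\mathbf{B}_iv_i-\sum_{k\in\mathcal{N}(i)}B_{ik}\sqrt{v_iv_k-s_{ik}(p)^2}\le q_i\ \ \forall i\in[n].$$ Condition (C) on $(v,\theta)$: $$\sum_{i=1}^n2\mathbf{B}_iv_i\,e_ie_i^{T}-\sum_{(i,k)\in\mathcal{E}}\frac{B_{ik}v_iv_k}{c_{ik}}(e_i+e_k)(e_i+e_k)^{T}\succeq0,\qquad c_{ik}:=\sqrt{v_iv_k}\cos(\theta_i-\theta_k)>0\ \ \forall(i,k)\in\mathcal{E},$$ where $e_1,\dots,e_n$ are the standard basis vectors of $\mathbb{R}^n$ and $e_0:=0$. Sensitivity matrix. $\frac{\partial v}{\partial q}$ at a solution denotes, for fixed $p$, the inverse of the Jacobian $\frac{\partial q}{\partial v}$ of the map $v\mapsto\bigl(\mathbf{B}_iv_i-\sum_{k\in\mathcal{N}(i)}B_{ik}\sqrt{v_iv_k-s_{ik}(p)^2}\bigr)_{i\in[n]}$ evaluated at that solution.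
   Formalization: Voltage-regularity is mended: ∂v/∂q need not exist on the boundary of S and vanishes between different subtrees of bus 0. Proved: it exists for (p,q) interior to S; where it exists, entries are ≥ 0, and > 0 if i,k lie in the same subtree of bus 0. *)

theory Defs
  imports "HOL-Analysis.Analysis"
begin

text \<open>
  Buses other than the root are indexed by a finite type \<open>'n\<close> (so \<open>n = CARD('n)\<close>); the root
  bus 0 is \<open>None\<close> and bus \<open>i \<in> [n]\<close> is \<open>Some i\<close>. An edge set \<open>E\<close> contains each
  line exactly once, as an ordered pair pointing away from the root.
\<close>

type_synonym 'n bus = "'n option"

abbreviation adjacency :: "('n bus \<times> 'n bus) set \<Rightarrow> ('n bus \<times> 'n bus) set" where
  "adjacency E \<equiv> E \<union> E\<inverse>"

definition is_cycle :: "('n bus \<times> 'n bus) set \<Rightarrow> 'n bus list \<Rightarrow> bool" where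
  "is_cycle E xs \<longleftrightarrow> 3 \<le> length xs \<and> distinct xs \<and>
     (\<forall>j < length xs. (xs ! j, xs ! (Suc j mod length xs)) \<in> adjacency E)"

definition rooted_tree :: "('n bus \<times> 'n bus) set \<Rightarrow> bool" where
  "rooted_tree E \<longleftrightarrow>
     asym E \<and>
     (\<forall>i k. (i, k) \<in> (adjacency E)\<^sup>*) \<and>
     (\<nexists>xs. is_cycle E xs) \<and>
     (\<forall>(i, k) \<in> E. (None, i) \<in> E\<^sup>*)"

definition nbrs :: "('n bus \<times> 'n bus) set \<Rightarrow> 'n bus \<Rightarrow> 'n bus set" where
  "nbrs E i = {k. (i, k) \<in> adjacency E}"

definition line_weights :: "('n bus \<times> 'n bus) set \<Rightarrow> ('n bus \<Rightarrow> 'n bus \<Rightarrow> real) \<Rightarrow> bool" where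
  "line_weights E B \<longleftrightarrow> (\<forall>(i, k) \<in> E. B i k = B k i \<and> 0 < B i k)"

definition Btot :: "('n bus \<times> 'n bus) set \<Rightarrow> ('n bus \<Rightarrow> 'n bus \<Rightarrow> real) \<Rightarrow> 'n bus \<Rightarrow> real" where
  "Btot E B i = (\<Sum>k \<in> nbrs E i. B i k)"

text \<open>Squared voltage magnitudes on all buses, with \<open>v\<^sub>0 = 1\<close>.\<close>

definition volt :: "real^'n \<Rightarrow> 'n bus \<Rightarrow> real" where
  "volt v b = (case b of None \<Rightarrow> 1 | Some i \<Rightarrow> v $ i)"

definition positive_vec :: "real^'n \<Rightarrow> bool" where
  "positive_vec v \<longleftrightarrow> (\<forall>i. 0 < v $ i)"


text \<open>Flows live on the lines only; they are set to 0 elsewhere so that they are unique as functions.\<close>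

definition is_flow ::
  "('n bus \<times> 'n bus) set \<Rightarrow> ('n bus \<Rightarrow> 'n bus \<Rightarrow> real) \<Rightarrow> real^'n \<Rightarrow> ('n bus \<Rightarrow> 'n bus \<Rightarrow> real) \<Rightarrow> bool" where
  "is_flow E B p s \<longleftrightarrow>
     (\<forall>i k. s k i = - s i k) \<and>
     (\<forall>i k. k \<notin> nbrs E i \<longrightarrow> s i k = 0) \<and>
     (\<forall>i. (\<Sum>k \<in> nbrs E (Some i). B (Some i) k * s (Some i) k) = p $ i)"

definition flow ::
  "('n bus \<times> 'n bus) set \<Rightarrow> ('n bus \<Rightarrow> 'n bus \<Rightarrow> real) \<Rightarrow> real^'n \<Rightarrow> 'n bus \<Rightarrow> 'n bus \<Rightarrow> real" where
  "flow E B p = (THE s. is_flow E B p s)"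

definition PF_solution ::
  "('n bus \<times> 'n bus) set \<Rightarrow> ('n bus \<Rightarrow> 'n bus \<Rightarrow> real) \<Rightarrow> real^'n \<Rightarrow> real^'n
    \<Rightarrow> real^'n \<Rightarrow> ('n bus \<Rightarrow> 'n bus \<Rightarrow> real) \<Rightarrow> bool" where
  "PF_solution E B p q v c \<longleftrightarrow>
     positive_vec v \<and>
     (\<forall>(i, k) \<in> E. c i k = c k i) \<and>
     (\<forall>i. Btot E B (Some i) * v $ i
            - (\<Sum>k \<in> nbrs E (Some i). B (Some i) k * c (Some i) k) = q $ i) \<and>
     (\<forall>(i, k) \<in> E. (flow E B p i k)\<^sup>2 + (c i k)\<^sup>2 = volt v i * volt v k)"

definition PF_polar_solution ::
  "('n bus \<times> 'n bus) set \<Rightarrow> ('n bus \<Rightarrow> 'n bus \<Rightarrow> real) \<Rightarrow> real^'n \<Rightarrow> real^'n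
    \<Rightarrow> real^'n \<Rightarrow> real^('n::finite bus) \<Rightarrow> bool" where
  "PF_polar_solution E B p q v \<theta> \<longleftrightarrow>
     positive_vec v \<and> \<theta> $ None = 0 \<and>
     (\<forall>i. (\<Sum>k \<in> nbrs E (Some i).
            B (Some i) k * (sqrt (v $ i * volt v k) * sin (\<theta> $ Some i - \<theta> $ k))) = p $ i) \<and>
     (\<forall>i. Btot E B (Some i) * v $ i
            - (\<Sum>k \<in> nbrs E (Some i).
                B (Some i) k * (sqrt (v $ i * volt v k) * cos (\<theta> $ Some i - \<theta> $ k))) = q $ i)"

definition same_phases :: "real^('n::finite bus) \<Rightarrow> real^('n::finite bus) \<Rightarrow> bool" where
  "same_phases \<theta> \<theta>' \<longleftrightarrow> (\<forall>i. \<exists>m::int. \<theta>' $ i = \<theta> $ i + 2 * pi * of_int m)"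


definition qmap ::
  "('n bus \<times> 'n bus) set \<Rightarrow> ('n bus \<Rightarrow> 'n bus \<Rightarrow> real) \<Rightarrow> real^'n \<Rightarrow> real^'n \<Rightarrow> real^'n" where
  "qmap E B p v = (\<chi> i. Btot E B (Some i) * v $ i
     - (\<Sum>k \<in> nbrs E (Some i).
          B (Some i) k * sqrt (v $ i * volt v k - (flow E B p (Some i) k)\<^sup>2)))"

text \<open>
  \<open>sqrt\<close> is total (and negative on negative arguments), so the requirement that the radicands
  in \<open>qmap\<close> be nonnegative has to be stated separately.
\<close>

definition qmap_domain ::
  "('n bus \<times> 'n bus) set \<Rightarrow> ('n bus \<Rightarrow> 'n bus \<Rightarrow> real) \<Rightarrow> real^'n \<Rightarrow> real^'n \<Rightarrow> bool" where
  "qmap_domain E B p v \<longleftrightarrow>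
     positive_vec v \<and> (\<forall>(i, k) \<in> E. (flow E B p i k)\<^sup>2 \<le> volt v i * volt v k)"

definition RPF_solution ::
  "('n bus \<times> 'n bus) set \<Rightarrow> ('n bus \<Rightarrow> 'n bus \<Rightarrow> real) \<Rightarrow> real^'n \<Rightarrow> real^'n \<Rightarrow> real^'n \<Rightarrow> bool" where
  "RPF_solution E B p q v \<longleftrightarrow> qmap_domain E B p v \<and> (\<forall>i. qmap E B p v $ i = q $ i)"

definition R_feasible ::
  "('n bus \<times> 'n bus) set \<Rightarrow> ('n bus \<Rightarrow> 'n bus \<Rightarrow> real) \<Rightarrow> real^'n \<Rightarrow> real^'n \<Rightarrow> real^'n \<Rightarrow> bool" where
  "R_feasible E B p q v \<longleftrightarrow> qmap_domain E B p v \<and> (\<forall>i. qmap E B p v $ i \<le> q $ i)"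

definition R_optimal ::
  "('n bus \<times> 'n bus) set \<Rightarrow> ('n bus \<Rightarrow> 'n bus \<Rightarrow> real) \<Rightarrow> real^'n
    \<Rightarrow> real^'n \<Rightarrow> real^'n \<Rightarrow> real^'n \<Rightarrow> bool" where
  "R_optimal E B w p q v \<longleftrightarrow>
     R_feasible E B p q v \<and>
     (\<forall>v'. R_feasible E B p q v' \<longrightarrow>
        (\<Sum>i\<in>UNIV. w $ i * ln (v' $ i)) \<le> (\<Sum>i\<in>UNIV. w $ i * ln (v $ i)))"

definition feasible_set ::
  "('n bus \<times> 'n bus) set \<Rightarrow> ('n bus \<Rightarrow> 'n bus \<Rightarrow> real) \<Rightarrow> ((real^'n) \<times> (real^'n)) set" where
  "feasible_set E B = {(p, q). \<exists>v. R_feasible E B p q v}"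

definition v_opt ::
  "('n bus \<times> 'n bus) set \<Rightarrow> ('n bus \<Rightarrow> 'n bus \<Rightarrow> real) \<Rightarrow> real^'n \<Rightarrow> real^'n \<Rightarrow> real^'n \<Rightarrow> real^'n" where
  "v_opt E B w p q = (THE v. R_optimal E B w p q v)"

definition recovers_phases ::
  "('n bus \<times> 'n bus) set \<Rightarrow> ('n bus \<Rightarrow> 'n bus \<Rightarrow> real) \<Rightarrow> real^'n \<Rightarrow> real^'n \<Rightarrow> real^('n::finite bus) \<Rightarrow> bool" where
  "recovers_phases E B p v \<theta> \<longleftrightarrow>
     \<theta> $ None = 0 \<and>
     (\<forall>(i, k) \<in> E. \<theta> $ i - \<theta> $ k = arcsin (flow E B p i k / sqrt (volt v i * volt v k)))"

definition theta_opt ::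
  "('n bus \<times> 'n bus) set \<Rightarrow> ('n bus \<Rightarrow> 'n bus \<Rightarrow> real) \<Rightarrow> real^'n
    \<Rightarrow> real^'n \<Rightarrow> real^'n \<Rightarrow> real^('n::finite bus)" where
  "theta_opt E B w p q = (THE \<theta>. recovers_phases E B p (v_opt E B w p q) \<theta>)"


definition high_voltage ::
  "('n bus \<times> 'n bus) set \<Rightarrow> ('n bus \<Rightarrow> 'n bus \<Rightarrow> real) \<Rightarrow> real^'n \<Rightarrow> real^'n \<Rightarrow> real^'n \<Rightarrow> bool" where
  "high_voltage E B p q v \<longleftrightarrow> (\<forall>v'. RPF_solution E B p q v' \<longrightarrow> (\<forall>i. v' $ i \<le> v $ i))"

definition positive_semidefinite :: "real^'n^'n \<Rightarrow> bool" where
  "positive_semidefinite A \<longleftrightarrow> transpose A = A \<and> (\<forall>x. 0 \<le> x \<bullet> (A *v x))"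

definition outer :: "real^'n \<Rightarrow> real^'n \<Rightarrow> real^'n^'n" where
  "outer x y = (\<chi> i j. x $ i * y $ j)"

text \<open>Standard basis vectors, with \<open>e\<^sub>0 = 0\<close>.\<close>

definition e_bus :: "'n bus \<Rightarrow> real^'n" where
  "e_bus b = (case b of None \<Rightarrow> 0 | Some i \<Rightarrow> axis i 1)"

definition c_polar :: "real^'n \<Rightarrow> real^('n::finite bus) \<Rightarrow> 'n bus \<Rightarrow> 'n bus \<Rightarrow> real" where
  "c_polar v \<theta> i k = sqrt (volt v i * volt v k) * cos (\<theta> $ i - \<theta> $ k)"

definition condition_C ::
  "('n bus \<times> 'n bus) set \<Rightarrow> ('n bus \<Rightarrow> 'n bus \<Rightarrow> real) \<Rightarrow> real^'n \<Rightarrow> real^('n::finite bus) \<Rightarrow> bool" where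
  "condition_C E B v \<theta> \<longleftrightarrow>
     (\<forall>(i, k) \<in> E. 0 < c_polar v \<theta> i k) \<and>
     positive_semidefinite
       ((\<Sum>i\<in>UNIV. (2 * Btot E B (Some i) * v $ i) *\<^sub>R outer (e_bus (Some i)) (e_bus (Some i)))
        - (\<Sum>(i, k)\<in>E. (B i k * volt v i * volt v k / c_polar v \<theta> i k) *\<^sub>R
             outer (e_bus i + e_bus k) (e_bus i + e_bus k)))"


text \<open>
  The sensitivity matrix \<open>\<partial>v/\<partial>q\<close> is the inverse of the Jacobian of \<open>qmap\<close>, and is
  defined only where that Jacobian exists and is invertible.
\<close>

definition has_sensitivity ::
  "('n bus \<times> 'n bus) set \<Rightarrow> ('n bus \<Rightarrow> 'n bus \<Rightarrow> real) \<Rightarrow> real^'n \<Rightarrow> real^'n \<Rightarrow> bool" where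
  "has_sensitivity E B p v \<longleftrightarrow>
     qmap E B p differentiable (at v) \<and> invertible (jacobian (qmap E B p) (at v))"

definition sensitivity ::
  "('n bus \<times> 'n bus) set \<Rightarrow> ('n bus \<Rightarrow> 'n bus \<Rightarrow> real) \<Rightarrow> real^'n \<Rightarrow> real^'n \<Rightarrow> real^'n^'n" where
  "sensitivity E B p v = matrix_inv (jacobian (qmap E B p) (at v))"

definition same_feeder :: "('n bus \<times> 'n bus) set \<Rightarrow> 'n \<Rightarrow> 'n \<Rightarrow> bool" where
  "same_feeder E i k \<longleftrightarrow>
     (Some i, Some k) \<in> {(a, b) \<in> adjacency E. a \<noteq> None \<and> b \<noteq> None}\<^sup>*"

text \<open>
  The voltage at the root is fixed, so the subtrees hanging from it do not interact: if \<open>i\<close>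
  and \<open>k\<close> lie in different ones, then \<open>\<partial>v\<^sub>i/\<partial>q\<^sub>k = 0\<close>.
  Strict positivity is therefore required within each such subtree and nonnegativity elsewhere;
  when the root has a single neighbour this is strict positivity of all entries
  (\<open>same_feederI_single\<close>). At a \<open>v\<close> where the Jacobian is singular (the saddle-node points on
  the boundary of \<open>feasible_set\<close>) there is no matrix \<open>\<partial>v/\<partial>q\<close> to speak of.
\<close>

definition voltage_regular ::
  "('n bus \<times> 'n bus) set \<Rightarrow> ('n bus \<Rightarrow> 'n bus \<Rightarrow> real) \<Rightarrow> real^'n \<Rightarrow> real^'n \<Rightarrow> bool" where
  "voltage_regular E B p v \<longleftrightarrow>
     (has_sensitivity E B p v \<longrightarrow>
       (\<forall>i k. 0 \<le> sensitivity E B p v $ i $ k \<and>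
              (same_feeder E i k \<longrightarrow> 0 < sensitivity E B p v $ i $ k)))"

lemma same_feederI_single:
  assumes "rooted_tree E" and "nbrs E None = {r}"
  shows "same_feeder E i k"
proof -
  let ?R = "{(a, b) \<in> adjacency E. a \<noteq> None \<and> b \<noteq> None}"
  have "r \<in> nbrs E None"
    using assms(2) by simp
  then have r: "r \<noteq> None"
    using assms(1) by (cases r) (auto simp: rooted_tree_def nbrs_def asym_iff)
  have *: "x = None \<or> (r, x) \<in> ?R\<^sup>*" if "(None, x) \<in> (adjacency E)\<^sup>*" for x
    using that
  proof (induction rule: rtrancl_induct)
    case base
    show ?case by simp
  next
    case (step y z)
    show ?case
    proof (cases "z = None \<or> y = None")
      case True
      then show ?thesis using step.hyps assms(2) by (auto simp: nbrs_def)
    next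
      case False
      then show ?thesis using step by (auto intro: rtrancl_into_rtrancl)
    qed
  qed
  have "(r, Some j) \<in> ?R\<^sup>*" for j
    using *[of "Some j"] assms(1) by (auto simp: rooted_tree_def)
  moreover have "sym (?R\<^sup>*)"
    by (rule sym_rtrancl) (auto simp: sym_def)
  ultimately show ?thesis
    unfolding same_feeder_def by (meson rtrancl_trans symD)
qed

end

theory Submission
  imports Defs
begin

text \<open>
  On a tree the flows depend linearly on \<open>p\<close>, and \<open>sqrt (v\<^sub>i v\<^sub>k - s\<^sub>i\<^sub>k\<^sup>2)\<close> is jointly concave and
  increasing in the neighbouring voltage. Hence the constraints of (R) are jointly convex, and the
  componentwise maximum of two feasible points is feasible. Since feasible sets are bounded, there
  is a greatest feasible point \<open>V\<close>; it is the optimum of (R) for any positive weights. No set of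
  buses can be raised from \<open>V\<close> without violating a constraint at a raised bus, which gives
  equality in all constraints, positivity of all radicands, and condition (C): otherwise a Perron
  eigenvector of the smallest eigenvalue of the symmetrised Jacobian would be a direction of
  feasible increase. Voltage regularity is inverse positivity of symmetric M-matrices.
  For continuity up to the boundary of the feasible set, a limit \<open>v\<close> of greatest points
  lies below \<open>V\<close>, and if \<open>v \<noteq> V\<close>, then strict convexity yields a point above \<open>v\<close>
  that has slack wherever \<open>v < V\<close> and thus remains feasible for nearby data.
\<close>

section \<open>Rooted trees and flows\<close>

text \<open>Maximality of \<open>V\<close> is exploited without multipliers or duality. A bus that
  is not raised keeps its constraint, because its own linear term is unchanged and the square roots
  can only grow; so a forbidden increase has to be tested at the raised buses only. The
  symmetrisation is the passage to relative changes \<open>dv i / v i\<close>: the Jacobian times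
  the diagonal matrix of \<open>v\<close> is, up to a factor 2, exactly the matrix of condition (C).
  Stability and voltage regularity thereby concern one symmetric matrix with nonpositive
  off-diagonal entries, and minimising a quadratic form takes the place of Perron theory for
  nonsymmetric matrices. The obstacle to continuity is the boundary of the feasible set: the
  Jacobian may be singular there, which blocks the implicit function theorem, and limits of feasible
  points may a priori have vanishing voltages or radicands. In the uniqueness claim, high voltage
  determines \<open>v\<close>, and the positive cosines in (C) determine the phases modulo full
  turns.\<close>

lemma rtrancl_imp_distinct_path:
  assumes "(a, b) \<in> R\<^sup>*"
  shows "\<exists>xs. xs \<noteq> [] \<and> hd xs = a \<and> last xs = b \<and> distinct xs \<and> set xs \<subseteq> insert a (Range R) \<and>
    successively (\<lambda>x y. (x, y) \<in> R) xs"
  using assms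
proof (induction rule: rtrancl_induct)
  case base
  show ?case by (rule exI[of _ "[a]"]) auto
next
  case (step y z)
  then obtain xs where xs: "xs \<noteq> []" "hd xs = a" "last xs = y" "distinct xs"
    "set xs \<subseteq> insert a (Range R)" "successively (\<lambda>x y. (x, y) \<in> R) xs" by blast
  show ?case
  proof (cases "z \<in> set xs")
    case True
    then obtain ys zs where "xs = ys @ z # zs" by (meson split_list)
    with xs show ?thesis
      by (intro exI[of _ "ys @ [z]"]) (auto simp: hd_append successively_append_iff split: if_splits)
  next
    case False
    with xs step.hyps show ?thesis
      by (intro exI[of _ "xs @ [z]"]) (auto simp: successively_append_iff)
  qed
qed

lemma distinct_path_imp_cycle:
  assumes "distinct xs" "3 \<le> length xs" "successively (\<lambda>x y. (x, y) \<in> adjacency E) xs"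
    and "(last xs, hd xs) \<in> adjacency E"
  shows "is_cycle E xs"
  unfolding is_cycle_def
proof (intro conjI allI impI)
  fix j assume j: "j < length xs"
  show "(xs ! j, xs ! (Suc j mod length xs)) \<in> adjacency E"
  proof (cases "Suc j < length xs")
    case True
    with assms(3) show ?thesis by (auto simp: successively_conv_nth)
  next
    case False
    with j have "j = length xs - 1" by simp
    moreover have "xs \<noteq> []" using j by auto
    ultimately show ?thesis using assms(4) by (simp add: last_conv_nth hd_conv_nth)
  qed
qed (use assms in auto)

section \<open>Parents, reachability and induction on the rooted tree\<close>

locale tree_network =
  fixes E :: "('n::finite bus \<times> 'n bus) set" and B :: "'n bus \<Rightarrow> 'n bus \<Rightarrow> real"
  assumes tree: "rooted_tree E" and weights: "line_weights E B"
begin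

lemma asym: "(a, b) \<in> E \<Longrightarrow> (b, a) \<notin> E"
  using tree by (auto simp: rooted_tree_def asym_iff)

lemma connected: "(a, b) \<in> (adjacency E)\<^sup>*"
  using tree by (simp add: rooted_tree_def)

lemma no_cycle: "\<not> is_cycle E xs"
  using tree by (simp add: rooted_tree_def)

text \<open>A directed closed walk using the edge \<open>(x, y)\<close> contains a simple path from
  \<open>y\<close> back to \<open>x\<close>. Asymmetry rules out fewer than three vertices, and a
  longer path closes up to a forbidden undirected cycle.\<close>

lemma acyclic_E: "acyclic E"
  unfolding acyclic_def
proof (intro allI notI)
  fix x assume "(x, x) \<in> E\<^sup>+"
  then obtain y where y: "(x, y) \<in> E" "(y, x) \<in> E\<^sup>*" by (meson tranclD)
  from rtrancl_imp_distinct_path[OF y(2)] obtain xs where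
    xs: "xs \<noteq> []" "hd xs = y" "last xs = x" "distinct xs" "successively (\<lambda>x y. (x, y) \<in> E) xs"
    by blast
  have "x \<noteq> y" using y asym by auto
  have "3 \<le> length xs"
  proof (rule ccontr)
    assume "\<not> 3 \<le> length xs"
    with xs(1) consider a where "xs = [a]" | a b where "xs = [a, b]"
      by (cases xs; cases "tl xs"; cases "tl (tl xs)") auto
    then show False using xs \<open>x \<noteq> y\<close> y asym by cases auto
  qed
  moreover have "successively (\<lambda>x y. (x, y) \<in> adjacency E) xs"
    using xs(5) by (rule successively_mono) auto
  ultimately have "is_cycle E xs"
    using xs y by (intro distinct_path_imp_cycle) auto
  then show False using no_cycle by blast
qed

text \<open>The definition of \<open>rooted_tree\<close> grants reachability from the root only for
  tails of edges. Along an undirected walk, an edge run backwards ends in a tail, and one run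
  forwards extends the path to its tail.\<close>

lemma reach_all: "(None, b) \<in> E\<^sup>*"
  using connected[of None b]
proof (induction rule: rtrancl_induct)
  case base
  show ?case by simp
next
  case (step y z)
  then show ?case using tree by (auto simp: rooted_tree_def)
qed

lemma root_no_parent: "(a, None) \<notin> E"
  using reach_all[of a] acyclic_E by (meson acyclic_def rtrancl_into_trancl1)

lemma tree_induct [case_names root edge]:
  assumes "P None" "\<And>a b. (a, b) \<in> E \<Longrightarrow> P a \<Longrightarrow> P b"
  shows "P b"
  using reach_all[of b] by (induction rule: rtrancl_induct) (use assms in auto)

text \<open>Induction from the leaves towards the root, dual to \<open>tree_induct\<close>. It suits
  flows: the flow on the line to the parent is determined by the flows to the children.\<close>

lemma leaf_induct [case_names step]:
  assumes "\<And>a. (\<And>b. (a, b) \<in> E \<Longrightarrow> P b) \<Longrightarrow> P a"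
  shows "P a"
proof -
  have "wf (E\<inverse>)" using acyclic_E by (intro finite_acyclic_wf_converse) auto
  then show ?thesis by (induction rule: wf_induct_rule) (use assms in auto)
qed

text \<open>A directed path to the parent \<open>a\<close> of \<open>x\<close> cannot meet
  \<open>x\<close>, since its remainder and the edge \<open>(a, x)\<close> would form a directed
  cycle.\<close>

lemma reach_avoiding:
  assumes "(c, a) \<in> E\<^sup>*" "(a, x) \<in> E"
  shows "(c, a) \<in> {(u, v) \<in> adjacency E. u \<noteq> x \<and> v \<noteq> x}\<^sup>*"
  using assms(1)
proof (induction rule: converse_rtrancl_induct)
  case base
  show ?case by simp
next
  case (step y z)
  have "(x, a) \<notin> E\<^sup>*" using assms(2) acyclic_E by (meson acyclic_def rtrancl_into_trancl1)
  then have "z \<noteq> x" "y \<noteq> x" using step.hyps converse_rtrancl_into_rtrancl[of y z E a] by auto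
  with step show ?case by (auto intro: converse_rtrancl_into_rtrancl)
qed

text \<open>Two parents of \<open>x\<close> are joined through the root by a path avoiding
  \<open>x\<close>, and adding \<open>x\<close> closes it to a cycle.\<close>

lemma parent_unique:
  assumes "(a, x) \<in> E" "(b, x) \<in> E"
  shows "a = b"
proof (rule ccontr)
  assume "a \<noteq> b"
  let ?R = "{(u, v) \<in> adjacency E. u \<noteq> x \<and> v \<noteq> x}"
  have "(None, a) \<in> ?R\<^sup>*" "(None, b) \<in> ?R\<^sup>*"
    using reach_avoiding reach_all assms by auto
  moreover have "sym (?R\<^sup>*)" by (rule sym_rtrancl) (auto simp: sym_def)
  ultimately have "(a, b) \<in> ?R\<^sup>*" by (meson rtrancl_trans symD)
  from rtrancl_imp_distinct_path[OF this] obtain xs where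
    xs: "xs \<noteq> []" "hd xs = a" "last xs = b" "distinct xs" "set xs \<subseteq> insert a (Range ?R)"
      "successively (\<lambda>x y. (x, y) \<in> ?R) xs"
    by blast
  \<comment> \<open>All vertices of the path except \<open>a\<close> lie in the range of a relation
    that avoids \<open>x\<close>; this is why \<open>rtrancl_imp_distinct_path\<close> keeps track
    of the vertex set.\<close>
  have "x \<notin> set xs" using xs(5) assms asym by auto
  have "successively (\<lambda>x y. (x, y) \<in> adjacency E) xs"
    using xs(6) by (rule successively_mono) auto
  moreover have "2 \<le> length xs"
    using xs(1-3) \<open>a \<noteq> b\<close> by (cases xs; cases "tl xs") auto
  ultimately have "is_cycle E (xs @ [x])"
    using xs \<open>x \<notin> set xs\<close> assms
    by (intro distinct_path_imp_cycle) (auto simp: successively_append_iff)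
  then show False using no_cycle by blast
qed

lemma parent_exists: "\<exists>a. (a, Some i) \<in> E"
  using reach_all[of "Some i"] by (metis option.distinct(1) rtranclE)

lemma nbrs_iff: "b \<in> nbrs E a \<longleftrightarrow> (a, b) \<in> E \<or> (b, a) \<in> E"
  by (auto simp: nbrs_def)

lemma nbrs_sym: "b \<in> nbrs E a \<longleftrightarrow> a \<in> nbrs E b"
  by (auto simp: nbrs_iff)

lemma nbrs_irrefl: "a \<notin> nbrs E a"
  using asym by (auto simp: nbrs_iff)

lemma weight_sym: "b \<in> nbrs E a \<Longrightarrow> B a b = B b a"
  using weights by (auto simp: nbrs_iff line_weights_def)

lemma weight_pos: "b \<in> nbrs E a \<Longrightarrow> 0 < B a b"
  using weights by (auto simp: nbrs_iff line_weights_def)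

lemma Btot_pos: "b \<in> nbrs E a \<Longrightarrow> 0 < Btot E B a"
  unfolding Btot_def by (rule sum_pos) (auto dest: weight_pos)

text \<open>Handshake identity: each line is seen once from either end, and asymmetry keeps the two
  orientations disjoint.\<close>

lemma sum_nbrs_eq_sum_edges:
  fixes f :: "'n bus \<Rightarrow> 'n bus \<Rightarrow> 'c::comm_monoid_add"
  shows "(\<Sum>a\<in>UNIV. \<Sum>b\<in>nbrs E a. f a b) = (\<Sum>(a, b)\<in>E. f a b + f b a)"
proof -
  have "(\<Sum>a\<in>UNIV. \<Sum>b\<in>nbrs E a. f a b) = (\<Sum>(a, b)\<in>adjacency E. f a b)"
    by (subst sum.Sigma) (auto simp: nbrs_def intro!: sum.cong)
  also have "\<dots> = (\<Sum>(a, b)\<in>E. f a b) + (\<Sum>(a, b)\<in>E\<inverse>. f a b)"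
    by (rule sum.union_disjoint) (auto dest: asym)
  also have "(\<Sum>(a, b)\<in>E\<inverse>. f a b) = (\<Sum>(a, b)\<in>E. f b a)"
    by (rule sum.reindex_bij_witness[of _ prod.swap prod.swap]) auto
  finally show ?thesis by (simp add: sum.distrib split_def)
qed

section \<open>Flows and their linear dependence on the injections\<close>

lemma is_flow_antisym: "is_flow E B p s \<Longrightarrow> s b a = - s a b"
  unfolding is_flow_def by blast

lemma is_flow_off: "is_flow E B p s \<Longrightarrow> b \<notin> nbrs E a \<Longrightarrow> s a b = 0"
  unfolding is_flow_def by blast

lemma is_flow_net:
  "is_flow E B p s \<Longrightarrow> (\<Sum>k\<in>nbrs E (Some i). B (Some i) k * s (Some i) k) = p $ i"
  unfolding is_flow_def by blast

lemma is_flowI: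
  assumes "\<And>a b. s b a = - s a b" "\<And>a b. b \<notin> nbrs E a \<Longrightarrow> s a b = 0"
    and "\<And>i. (\<Sum>k\<in>nbrs E (Some i). B (Some i) k * s (Some i) k) = p $ i"
  shows "is_flow E B p s"
  unfolding is_flow_def using assms by blast

text \<open>Starting from the leaves, the injection at a bus minus the flows to its children leaves
  only the line to the parent, whose weight is nonzero.\<close>

lemma is_flow_unique:
  assumes s: "is_flow E B p s" and t: "is_flow E B p t"
  shows "s = t"
proof -
  have up: "\<forall>b. (b, a) \<in> E \<longrightarrow> s a b = t a b" for a
  proof (induction a rule: leaf_induct)
    case (step a)
    show ?case
    proof (intro allI impI)
      fix b assume b: "(b, a) \<in> E"
      then obtain i where a: "a = Some i" using root_no_parent by (cases a) auto
      have bn: "b \<in> nbrs E a" using b by (auto simp: nbrs_iff)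
      have "s a k = t a k" if "k \<in> nbrs E a - {b}" for k
      proof -
        have "(a, k) \<in> E" using that b parent_unique by (auto simp: nbrs_iff)
        then have "s k a = t k a" using step by auto
        then show ?thesis
          using is_flow_antisym[OF s, of a k] is_flow_antisym[OF t, of a k] by simp
      qed
      then have "(\<Sum>k\<in>nbrs E a - {b}. B a k * s a k) = (\<Sum>k\<in>nbrs E a - {b}. B a k * t a k)"
        by (intro sum.cong) auto
      moreover have "(\<Sum>k\<in>nbrs E a. B a k * s a k) = (\<Sum>k\<in>nbrs E a. B a k * t a k)"
        using is_flow_net[OF s] is_flow_net[OF t] a by simp
      ultimately have "B a b * s a b = B a b * t a b"
        using bn by (simp add: sum.remove[of _ b])
      then show "s a b = t a b" using weight_pos[OF bn] by simp
    qed
  qed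
  show ?thesis
  proof (intro ext)
    fix a b
    consider "(a, b) \<in> E" | "(b, a) \<in> E" | "b \<notin> nbrs E a" by (auto simp: nbrs_iff)
    then show "s a b = t a b"
    proof cases
      case 1
      then have "s b a = t b a" using up by auto
      then show ?thesis
        using is_flow_antisym[OF s, of a b] is_flow_antisym[OF t, of a b] by simp
    qed (use up is_flow_off[OF s] is_flow_off[OF t] in auto)
  qed
qed

text \<open>A tree has as many lines as non-root buses, so a flow is encoded by a vector of the same
  dimension as \<open>p\<close>. The injections depend on this vector through a linear endomorphism,
  which is injective by \<open>is_flow_unique\<close> and hence surjective.\<close>

lemma is_flow_exists: "\<exists>s. is_flow E B p s"
proof -
  define X where "X = (\<lambda>(x::real^'n) b. case b of None \<Rightarrow> 0 | Some j \<Rightarrow> x $ j)"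
  \<comment> \<open>Here \<open>x $ i\<close> is the flow from bus \<open>i\<close> towards its
    parent.\<close>
  define sf where "sf = (\<lambda>x a b. if (b, a) \<in> E then X x a else if (a, b) \<in> E then - X x b else 0)"
  define T where "T = (\<lambda>x. \<chi> i. \<Sum>k\<in>nbrs E (Some i). B (Some i) k * sf x (Some i) k)"
  have X_lin: "X (x + y) b = X x b + X y b" "X (c *\<^sub>R x) b = c * X x b" for x y b c
    by (auto simp: X_def split: option.splits)
  have sf_lin: "sf (x + y) a b = sf x a b + sf y a b" "sf (c *\<^sub>R x) a b = c * sf x a b" for x y a b c
    by (auto simp: sf_def X_lin)
  have "linear T"
    by (rule linearI)
       (auto simp: T_def vec_eq_iff sf_lin distrib_left sum.distrib sum_distrib_left mult_ac)
  have flow: "is_flow E B (T x) (sf x)" for x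
    by (rule is_flowI) (use asym in \<open>auto simp: T_def sf_def nbrs_iff\<close>)
  have "inj T"
  proof (rule injI)
    fix x y assume "T x = T y"
    then have eq: "sf x = sf y" using flow is_flow_unique by metis
    have "x $ i = y $ i" for i
    proof -
      obtain a where "(a, Some i) \<in> E" using parent_exists by blast
      then show ?thesis using fun_cong[OF fun_cong[OF eq, of "Some i"], of a]
        by (simp add: sf_def X_def)
    qed
    then show "x = y" by (simp add: vec_eq_iff)
  qed
  with \<open>linear T\<close> have "surj T" by (rule linear_inj_imp_surj)
  then obtain x where "p = T x" by (metis surjD)
  with flow show ?thesis by auto
qed

lemma is_flow_ex1: "\<exists>!s. is_flow E B p s"
  using is_flow_exists is_flow_unique by blast

lemma is_flow_flow: "is_flow E B p (flow E B p)"
  unfolding flow_def by (rule theI'[OF is_flow_ex1])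

lemma flow_eqI: "is_flow E B p s \<Longrightarrow> flow E B p = s"
  using is_flow_flow is_flow_unique by blast

lemma flow_antisym: "flow E B p b a = - flow E B p a b"
  by (rule is_flow_antisym[OF is_flow_flow])

lemma flow_sq_sym: "(flow E B p b a)\<^sup>2 = (flow E B p a b)\<^sup>2"
  by (subst flow_antisym) simp

lemma flow_add: "flow E B (p + p') a b = flow E B p a b + flow E B p' a b"
proof -
  have "is_flow E B (p + p') (\<lambda>a b. flow E B p a b + flow E B p' a b)"
  proof (rule is_flowI)
    fix a b
    show "flow E B p b a + flow E B p' b a = - (flow E B p a b + flow E B p' a b)"
      using flow_antisym[of p b a] flow_antisym[of p' b a] by simp
  qed (simp_all add: is_flow_off[OF is_flow_flow] is_flow_net[OF is_flow_flow]
        distrib_left sum.distrib)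
  then show ?thesis by (simp add: flow_eqI)
qed

lemma flow_scale: "flow E B (c *\<^sub>R p) a b = c * flow E B p a b"
proof -
  have "is_flow E B (c *\<^sub>R p) (\<lambda>a b. c * flow E B p a b)"
  proof (rule is_flowI)
    fix a b
    show "c * flow E B p b a = - (c * flow E B p a b)"
      using flow_antisym[of p b a] by simp
  next
    fix i
    have "(\<Sum>k\<in>nbrs E (Some i). B (Some i) k * (c * flow E B p (Some i) k)) =
        c * (\<Sum>k\<in>nbrs E (Some i). B (Some i) k * flow E B p (Some i) k)"
      by (simp add: sum_distrib_left mult_ac)
    then show "(\<Sum>k\<in>nbrs E (Some i). B (Some i) k * (c * flow E B p (Some i) k)) = (c *\<^sub>R p) $ i"
      by (simp add: is_flow_net[OF is_flow_flow])
  qed (simp add: is_flow_off[OF is_flow_flow])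
  then show ?thesis by (simp add: flow_eqI)
qed

lemma bounded_linear_flow: "bounded_linear (\<lambda>p. flow E B p a b)"
  by (intro linear_conv_bounded_linear[THEN iffD1] linearI) (simp_all add: flow_add flow_scale)

lemma tendsto_flow: "(f \<longlongrightarrow> p) F \<Longrightarrow> ((\<lambda>x. flow E B (f x) a b) \<longlongrightarrow> flow E B p a b) F"
  by (rule bounded_linear.tendsto[OF bounded_linear_flow])

end

section \<open>The greatest feasible voltage vector\<close>

text \<open>Cauchy--Schwarz followed by AM--GM. This is the joint concavity of
  \<open>sqrt (x * y - s\<^sup>2)\<close> in polarised form.\<close>

lemma reverse_cauchy_schwarz:
  fixes x y x' y' c c' s s' :: real
  assumes "0 \<le> x" "0 \<le> y" "0 \<le> x'" "0 \<le> y'" "c\<^sup>2 + s\<^sup>2 \<le> x * y" "c'\<^sup>2 + s'\<^sup>2 \<le> x' * y'"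
  shows "c * c' + s * s' \<le> (x * y' + x' * y) / 2"
proof -
  have "(c * c' + s * s')\<^sup>2 + (c * s' - s * c')\<^sup>2 = (c\<^sup>2 + s\<^sup>2) * (c'\<^sup>2 + s'\<^sup>2)"
    by (simp add: power2_eq_square algebra_simps)
  then have "(c * c' + s * s')\<^sup>2 \<le> (c\<^sup>2 + s\<^sup>2) * (c'\<^sup>2 + s'\<^sup>2)"
    by (metis zero_le_power2 le_add_same_cancel1)
  also have "\<dots> \<le> (x * y) * (x' * y')"
    using assms by (intro mult_mono) auto
  also have "\<dots> = ((x * y' + x' * y) / 2)\<^sup>2 - ((x * y' - x' * y) / 2)\<^sup>2"
    by (simp add: power2_eq_square field_simps)
  also have "\<dots> \<le> ((x * y' + x' * y) / 2)\<^sup>2"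
    by simp
  finally show ?thesis
    by (rule power2_le_imp_le) (use assms in simp)
qed

text \<open>After expanding the squares only cross terms remain to be compared, and
  \<open>reverse_cauchy_schwarz\<close> does this. One inequality then yields both claims:
  nonnegativity of the new radicand and concavity.\<close>

lemma edge_concave:
  fixes x y x' y' s s' :: real
  assumes nn: "0 \<le> x" "0 \<le> y" "0 \<le> x'" "0 \<le> y'" and dom: "s\<^sup>2 \<le> x * y" "s'\<^sup>2 \<le> x' * y'"
    and uv: "0 \<le> u" "0 \<le> v"
  shows "(u * s + v * s')\<^sup>2 \<le> (u * x + v * x') * (u * y + v * y')"
    and "u * sqrt (x * y - s\<^sup>2) + v * sqrt (x' * y' - s'\<^sup>2) \<le>
      sqrt ((u * x + v * x') * (u * y + v * y') - (u * s + v * s')\<^sup>2)"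
proof -
  define c c' where "c = sqrt (x * y - s\<^sup>2)" and "c' = sqrt (x' * y' - s'\<^sup>2)"
  have c: "c\<^sup>2 + s\<^sup>2 = x * y" "c'\<^sup>2 + s'\<^sup>2 = x' * y'"
    using dom by (simp_all add: c_def c'_def)
  have "u * v * (c * c' + s * s') \<le> u * v * ((x * y' + x' * y) / 2)"
    by (intro mult_left_mono reverse_cauchy_schwarz) (use nn c uv in auto)
  moreover have "(u * c + v * c')\<^sup>2 + (u * s + v * s')\<^sup>2 =
      u\<^sup>2 * (c\<^sup>2 + s\<^sup>2) + v\<^sup>2 * (c'\<^sup>2 + s'\<^sup>2) + 2 * (u * v * (c * c' + s * s'))"
    by (simp add: power2_eq_square algebra_simps)
  moreover have "(u * x + v * x') * (u * y + v * y') =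
      u\<^sup>2 * (x * y) + v\<^sup>2 * (x' * y') + 2 * (u * v * ((x * y' + x' * y) / 2))"
    by (simp add: power2_eq_square algebra_simps)
  ultimately have *: "(u * c + v * c')\<^sup>2 + (u * s + v * s')\<^sup>2 \<le> (u * x + v * x') * (u * y + v * y')"
    by (simp add: c)
  then show "(u * s + v * s')\<^sup>2 \<le> (u * x + v * x') * (u * y + v * y')"
    by (metis add_increasing order_trans zero_le_power2 order_refl)
  show "u * sqrt (x * y - s\<^sup>2) + v * sqrt (x' * y' - s'\<^sup>2) \<le>
      sqrt ((u * x + v * x') * (u * y + v * y') - (u * s + v * s')\<^sup>2)"
    using * by (intro real_le_rsqrt) (simp add: c_def c'_def)
qed

text \<open>The tangent plane of a concave function lies above its graph; \<open>y / (2 * c)\<close>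
  and \<open>x / (2 * c)\<close> are the partial derivatives. Taking equal flows in
  \<open>reverse_cauchy_schwarz\<close> and dividing by \<open>2 * c\<close> gives this without
  differentiating.\<close>

lemma edge_gradient:
  fixes x y x' y' s c :: real
  assumes nn: "0 \<le> x" "0 \<le> y" "0 \<le> x'" "0 \<le> y'" and dom: "s\<^sup>2 \<le> x' * y'"
    and c: "c = sqrt (x * y - s\<^sup>2)" "0 < c"
  shows "sqrt (x' * y' - s\<^sup>2) \<le> c + (x * (y' - y) + y * (x' - x)) / (2 * c)"
proof -
  define c' where "c' = sqrt (x' * y' - s\<^sup>2)"
  have "0 < x * y - s\<^sup>2" using c by simp
  then have c2: "c\<^sup>2 + s\<^sup>2 = x * y" using c(1) by simp
  have "c'\<^sup>2 + s\<^sup>2 = x' * y'" using dom by (simp add: c'_def)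
  then have "c * c' + s * s \<le> (x * y' + x' * y) / 2"
    using nn c2 by (intro reverse_cauchy_schwarz) auto
  then have "2 * c * c' \<le> 2 * c * c + (x * (y' - y) + y * (x' - x))"
    using c2 by (simp add: power2_eq_square algebra_simps)
  then show ?thesis
    using c(2) unfolding c'_def[symmetric] by (simp add: field_simps)
qed

section \<open>Monotonicity of the constraint map\<close>

lemma volt_simps [simp]: "volt v None = 1" "volt v (Some i) = v $ i"
  by (simp_all add: volt_def)

lemma volt_pos: "positive_vec v \<Longrightarrow> 0 < volt v b"
  by (cases b) (auto simp: positive_vec_def)

lemma volt_nonneg: "(\<And>i. 0 \<le> v $ i) \<Longrightarrow> 0 \<le> volt v b"
  by (cases b) auto

lemma volt_mono: "u \<le> v \<Longrightarrow> volt u b \<le> volt v b"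
  by (cases b) (auto simp: less_eq_vec_def)

lemma tendsto_volt: "(f \<longlongrightarrow> v) F \<Longrightarrow> ((\<lambda>x. volt (f x) b) \<longlongrightarrow> volt v b) F"
  by (cases b) (auto intro: tendsto_vec_nth)

context tree_network
begin

lemma qmap_nth:
  "qmap E B p v $ i =
    (\<Sum>k\<in>nbrs E (Some i). B (Some i) k * (v $ i - sqrt (v $ i * volt v k - (flow E B p (Some i) k)\<^sup>2)))"
  by (simp add: qmap_def Btot_def right_diff_distrib sum_subtractf sum_distrib_right)

lemma tendsto_qmap:
  assumes "(f \<longlongrightarrow> p) F" "(g \<longlongrightarrow> v) F"
  shows "((\<lambda>x. qmap E B (f x) (g x) $ i) \<longlongrightarrow> qmap E B p v $ i) F"
  unfolding qmap_nth
  by (intro tendsto_intros tendsto_flow tendsto_volt assms)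

lemma domain_nbr:
  assumes "qmap_domain E B p v" "b \<in> nbrs E a"
  shows "(flow E B p a b)\<^sup>2 \<le> volt v a * volt v b"
  using assms flow_sq_sym[of p a b] by (auto simp: qmap_domain_def nbrs_iff mult.commute)

lemma domain_mono:
  assumes "qmap_domain E B p v" "v \<le> z"
  shows "qmap_domain E B p z"
  unfolding qmap_domain_def
proof (intro conjI ballI)
  have pos: "positive_vec v" using assms by (simp add: qmap_domain_def)
  then show "positive_vec z"
    using assms by (auto simp: positive_vec_def less_eq_vec_def intro: less_le_trans)
  fix x assume "x \<in> E"
  moreover obtain a b where x: "x = (a, b)" by force
  ultimately have "(flow E B p a b)\<^sup>2 \<le> volt v a * volt v b"
    using assms by (auto simp: qmap_domain_def)
  also have "\<dots> \<le> volt z a * volt z b"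
    using volt_mono[OF assms(2)] volt_pos[OF pos] less_le_trans[OF volt_pos[OF pos] volt_mono[OF assms(2)]]
    by (intro mult_mono) (auto intro: less_imp_le)
  finally show "case x of (i, k) \<Rightarrow> (flow E B p i k)\<^sup>2 \<le> volt z i * volt z k" by (simp add: x)
qed

text \<open>Neighbouring voltages enter only through the square roots, which grow with them. A bus
  held fixed therefore gains slack when others rise.\<close>

lemma qmap_mono:
  assumes "u \<le> v" "u $ i = v $ i" "0 \<le> u $ i"
  shows "qmap E B p v $ i \<le> qmap E B p u $ i"
  unfolding qmap_nth
proof (rule sum_mono)
  fix k assume k: "k \<in> nbrs E (Some i)"
  have "u $ i * volt u k \<le> v $ i * volt v k"
    using assms volt_mono[OF assms(1), of k] by (simp add: mult_left_mono)
  then show "B (Some i) k * (v $ i - sqrt (v $ i * volt v k - (flow E B p (Some i) k)\<^sup>2)) \<le>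
      B (Some i) k * (u $ i - sqrt (u $ i * volt u k - (flow E B p (Some i) k)\<^sup>2))"
    using assms weight_pos[OF k] by simp
qed

lemma qmap_strict_mono:
  assumes "u \<le> v" "u $ i = v $ i" "0 < u $ i" "Some j \<in> nbrs E (Some i)" "u $ j < v $ j"
  shows "qmap E B p v $ i < qmap E B p u $ i"
  unfolding qmap_nth
proof (rule sum_strict_mono_ex1)
  show "\<forall>k\<in>nbrs E (Some i). B (Some i) k * (v $ i - sqrt (v $ i * volt v k - (flow E B p (Some i) k)\<^sup>2)) \<le>
      B (Some i) k * (u $ i - sqrt (u $ i * volt u k - (flow E B p (Some i) k)\<^sup>2))"
  proof
    fix k assume k: "k \<in> nbrs E (Some i)"
    have "u $ i * volt u k \<le> v $ i * volt v k"
      using assms volt_mono[OF assms(1), of k] by (simp add: mult_left_mono)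
    then show "B (Some i) k * (v $ i - sqrt (v $ i * volt v k - (flow E B p (Some i) k)\<^sup>2)) \<le>
        B (Some i) k * (u $ i - sqrt (u $ i * volt u k - (flow E B p (Some i) k)\<^sup>2))"
      using assms weight_pos[OF k] by simp
  qed
  show "\<exists>k\<in>nbrs E (Some i). B (Some i) k * (v $ i - sqrt (v $ i * volt v k - (flow E B p (Some i) k)\<^sup>2)) <
      B (Some i) k * (u $ i - sqrt (u $ i * volt u k - (flow E B p (Some i) k)\<^sup>2))"
  proof (rule bexI[OF _ assms(4)])
    have "u $ i * u $ j < v $ i * v $ j" using assms by simp
    then show "B (Some i) (Some j) * (v $ i - sqrt (v $ i * volt v (Some j) - (flow E B p (Some i) (Some j))\<^sup>2)) <
        B (Some i) (Some j) * (u $ i - sqrt (u $ i * volt u (Some j) - (flow E B p (Some i) (Some j))\<^sup>2))"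
      using assms weight_pos[OF assms(4)] by simp
  qed
qed auto

text \<open>Radicands only grow when voltages rise, and buses left in place are covered by
  \<open>qmap_mono\<close>. Hence only the raised buses have to be checked.\<close>

lemma feasible_raise:
  assumes v: "R_feasible E B p q v" and vz: "v \<le> z"
    and z: "\<And>i. v $ i < z $ i \<Longrightarrow> qmap E B p z $ i \<le> q $ i"
  shows "R_feasible E B p q z"
  unfolding R_feasible_def
proof (intro conjI allI)
  show "qmap_domain E B p z" using v vz domain_mono by (auto simp: R_feasible_def)
  fix i
  have "0 < v $ i" using v by (auto simp: R_feasible_def qmap_domain_def positive_vec_def)
  show "qmap E B p z $ i \<le> q $ i"
  proof (cases "v $ i < z $ i")
    case False
    then have "v $ i = z $ i" using vz by (auto simp: less_eq_vec_def intro: antisym)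
    with qmap_mono[OF vz this] \<open>0 < v $ i\<close> v show ?thesis
      by (auto simp: R_feasible_def intro: order_trans)
  qed (rule z)
qed

text \<open>The maximum exceeds \<open>v\<close> only where it equals \<open>u\<close>, and there
  the constraint of \<open>u\<close> is passed on by \<open>qmap_mono\<close>. The two arguments are
  treated asymmetrically so that \<open>u\<close> may be a limit of feasible points with vanishing
  voltages.\<close>

lemma feasible_max:
  assumes v: "R_feasible E B p q v" and u: "\<And>i. 0 \<le> u $ i" "\<And>i. qmap E B p u $ i \<le> q $ i"
  shows "R_feasible E B p q (\<chi> i. max (u $ i) (v $ i))"
proof (rule feasible_raise[OF v])
  show "v \<le> (\<chi> i. max (u $ i) (v $ i))" by (simp add: less_eq_vec_def)
  fix i assume i: "v $ i < (\<chi> i. max (u $ i) (v $ i)) $ i"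
  then have "qmap E B p (\<chi> i. max (u $ i) (v $ i)) $ i \<le> qmap E B p u $ i"
    using u by (intro qmap_mono) (auto simp: less_eq_vec_def)
  with u(2)[of i] show "qmap E B p (\<chi> i. max (u $ i) (v $ i)) $ i \<le> q $ i" by simp
qed

lemma feasible_pos: "R_feasible E B p q v \<Longrightarrow> 0 < v $ i"
  by (simp add: R_feasible_def qmap_domain_def positive_vec_def)

section \<open>An a priori bound on feasible voltages\<close>

lemma sum_bus: "(\<Sum>a\<in>(UNIV :: 'n bus set). f a) = f None + (\<Sum>i\<in>UNIV. f (Some i))"
  for f :: "'n bus \<Rightarrow> 'c::comm_monoid_add"
  by (simp add: UNIV_option_conv sum.reindex)

text \<open>In the sum of all constraints, a line contributes
  \<open>B a b * (volt v a + volt v b - 2 * c)\<close> with \<open>c\<close> at most the geometric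
  mean of the voltages. Each contribution thus dominates a square, and a single one is bounded by
  the total.\<close>

lemma feasible_edge_bound:
  assumes v: "R_feasible E B p q v" and e: "(a, b) \<in> E"
  shows "B a b * (sqrt (volt v a) - sqrt (volt v b))\<^sup>2 \<le> (\<Sum>i\<in>UNIV. \<bar>q $ i\<bar>) + Btot E B None"
proof -
  define f where "f = (\<lambda>a b. B a b * (volt v a - sqrt (volt v a * volt v b - (flow E B p a b)\<^sup>2)))"
  have vp: "0 < volt v a" for a using v volt_pos by (auto simp: R_feasible_def qmap_domain_def)
  have edge: "B a b * (sqrt (volt v a) - sqrt (volt v b))\<^sup>2 \<le> f a b + f b a" if "(a, b) \<in> E" for a b
  proof -
    have nb: "b \<in> nbrs E a" using that by (simp add: nbrs_iff)
    have "sqrt (volt v a * volt v b - (flow E B p a b)\<^sup>2) \<le> sqrt (volt v a) * sqrt (volt v b)"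
      by (simp add: real_sqrt_mult[symmetric])
    moreover have "(sqrt (volt v a) - sqrt (volt v b))\<^sup>2 =
        volt v a + volt v b - 2 * (sqrt (volt v a) * sqrt (volt v b))"
      using vp[of a] vp[of b] by (simp add: power2_diff)
    ultimately have "(sqrt (volt v a) - sqrt (volt v b))\<^sup>2 \<le>
        volt v a + volt v b - 2 * sqrt (volt v a * volt v b - (flow E B p a b)\<^sup>2)" by simp
    then have "B a b * (sqrt (volt v a) - sqrt (volt v b))\<^sup>2 \<le>
        B a b * (volt v a + volt v b - 2 * sqrt (volt v a * volt v b - (flow E B p a b)\<^sup>2))"
      using weight_pos[OF nb] by simp
    also have "\<dots> = f a b + f b a"
      using weight_sym[OF nb] flow_sq_sym[of p a b] by (simp add: f_def algebra_simps)
    finally show ?thesis .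
  qed
  have "B a b * (sqrt (volt v a) - sqrt (volt v b))\<^sup>2 \<le> f a b + f b a" using edge e .
  also have "\<dots> \<le> (\<Sum>(a, b)\<in>E. f a b + f b a)"
  proof -
    have "0 \<le> f c d + f d c" if "(c, d) \<in> E" for c d
    proof -
      have "0 \<le> B c d * (sqrt (volt v c) - sqrt (volt v d))\<^sup>2"
        using weight_pos[of d c] that by (simp add: nbrs_iff)
      also note edge[OF that]
      finally show ?thesis .
    qed
    then have "(case (a, b) of (a, b) \<Rightarrow> f a b + f b a) \<le> (\<Sum>(a, b)\<in>E. f a b + f b a)"
      by (intro member_le_sum[OF e]) auto
    then show ?thesis by simp
  qed
  also have "\<dots> = (\<Sum>a\<in>UNIV. \<Sum>b\<in>nbrs E a. f a b)"
    by (rule sum_nbrs_eq_sum_edges[symmetric])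
  \<comment> \<open>The root has no constraint in (R). Its row is bounded separately, using that its
    voltage is 1 and the square roots are nonnegative.\<close>
  also have "\<dots> = (\<Sum>b\<in>nbrs E None. f None b) + (\<Sum>i\<in>UNIV. qmap E B p v $ i)"
    by (simp add: sum_bus f_def qmap_nth)
  also have "(\<Sum>b\<in>nbrs E None. f None b) \<le> Btot E B None"
    unfolding Btot_def
  proof (rule sum_mono)
    fix b assume b: "b \<in> nbrs E None"
    have "0 \<le> sqrt (volt v b - (flow E B p None b)\<^sup>2)"
      using v domain_nbr[OF _ b, of p v] by (simp add: R_feasible_def)
    then show "f None b \<le> B None b"
      using weight_pos[OF b] by (simp add: f_def mult_left_le)
  qed
  also have "(\<Sum>i\<in>UNIV. qmap E B p v $ i) \<le> (\<Sum>i\<in>UNIV. \<bar>q $ i\<bar>)"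
    using v by (intro sum_mono) (auto simp: R_feasible_def intro: order_trans)
  finally show ?thesis by simp
qed

text \<open>The edge bound propagates down the tree from the root voltage 1. The constant depends on
  the data only through \<open>M\<close>, so that it serves a whole convergent sequence of data at
  once.\<close>

lemma feasible_volt_bound:
  "\<exists>K. \<forall>p q v. R_feasible E B p q v \<longrightarrow> (\<Sum>i\<in>UNIV. \<bar>q $ i\<bar>) \<le> M \<longrightarrow> volt v b \<le> K"
proof (induction b rule: tree_induct)
  case root
  show ?case by (auto intro: exI[of _ 1])
next
  case (edge a b)
  then obtain K where K: "\<And>p q v. R_feasible E B p q v \<Longrightarrow> (\<Sum>i\<in>UNIV. \<bar>q $ i\<bar>) \<le> M \<Longrightarrow> volt v a \<le> K"
    by blast
  define L where "L = sqrt K + sqrt ((M + Btot E B None) / B a b)"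
  have "volt v b \<le> L\<^sup>2" if v: "R_feasible E B p q v" and M: "(\<Sum>i\<in>UNIV. \<bar>q $ i\<bar>) \<le> M" for p q v
  proof -
    have Bp: "0 < B a b" using edge weight_pos by (auto simp: nbrs_iff)
    have vp: "0 < volt v a" for a using v volt_pos by (auto simp: R_feasible_def qmap_domain_def)
    have "B a b * (sqrt (volt v a) - sqrt (volt v b))\<^sup>2 \<le> M + Btot E B None"
      using feasible_edge_bound[OF v edge.hyps] M by simp
    then have "(sqrt (volt v b) - sqrt (volt v a))\<^sup>2 \<le> (M + Btot E B None) / B a b"
      using Bp by (simp add: field_simps power2_commute)
    then have "sqrt (volt v b) - sqrt (volt v a) \<le> sqrt ((M + Btot E B None) / B a b)"
      by (rule real_le_rsqrt)
    moreover have "sqrt (volt v a) \<le> sqrt K" using K[OF v M] by (rule real_sqrt_le_mono)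
    ultimately have "sqrt (volt v b) \<le> L" unfolding L_def by linarith
    then have "(sqrt (volt v b))\<^sup>2 \<le> L\<^sup>2" using vp[of b] by (intro power_mono) auto
    then show ?thesis using vp[of b] by simp
  qed
  then show ?case by blast
qed

lemma feasible_bound:
  obtains K where
    "\<And>p q v i. R_feasible E B p q v \<Longrightarrow> (\<Sum>i\<in>UNIV. \<bar>q $ i\<bar>) \<le> M \<Longrightarrow> v $ i \<le> K"
proof -
  from feasible_volt_bound[of M] obtain K where
    K: "\<And>b p q v. R_feasible E B p q v \<Longrightarrow> (\<Sum>i\<in>UNIV. \<bar>q $ i\<bar>) \<le> M \<Longrightarrow> volt v b \<le> K b"
    by metis
  show thesis
  proof (rule that)
    fix p q v i assume "R_feasible E B p q v" "(\<Sum>i\<in>UNIV. \<bar>q $ i\<bar>) \<le> M"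
    then have "v $ i \<le> K (Some i)" using K[of p q v "Some i"] by simp
    also have "\<dots> \<le> Max (range K)" by (intro Max_ge) auto
    finally show "v $ i \<le> Max (range K)" .
  qed
qed

section \<open>The greatest feasible point and the consequences of maximality\<close>

definition greatest_feasible :: "real^'n \<Rightarrow> real^'n \<Rightarrow> real^'n \<Rightarrow> bool" where
  "greatest_feasible p q V \<longleftrightarrow> R_feasible E B p q V \<and> (\<forall>v. R_feasible E B p q v \<longrightarrow> v \<le> V)"

text \<open>The suprema of different components may be approached by different feasible points, so
  no single sequence need converge to \<open>V\<close>. The constraints are instead verified one row
  at a time.\<close>

lemma greatest_feasible_exists:
  assumes v0: "R_feasible E B p q v0"
  shows "\<exists>V. greatest_feasible p q V"
proof -
  define A where "A = (\<lambda>i. {v $ i |v. R_feasible E B p q v})"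
  define V where "V = (\<chi> i. Sup (A i))"
  obtain K where K: "\<And>v i. R_feasible E B p q v \<Longrightarrow> v $ i \<le> K"
    using feasible_bound[of "\<Sum>i\<in>UNIV. \<bar>q $ i\<bar>"] by (metis order_refl)
  have bdd: "bdd_above (A i)" for i using K by (auto simp: A_def intro!: bdd_aboveI[of _ K])
  have ne: "A i \<noteq> {}" for i using v0 by (auto simp: A_def)
  have le: "v \<le> V" if "R_feasible E B p q v" for v
    using that bdd by (auto simp: less_eq_vec_def V_def A_def intro!: cSup_upper)
  have "qmap E B p V $ i \<le> q $ i" for i
  proof -
    \<comment> \<open>Row \<open>i\<close> with the neighbours already at their suprema. This only
      lowers it for each feasible \<open>v\<close>, and then the supremum over the single number
      \<open>v $ i\<close> can be taken by closedness.\<close>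
    define \<phi> where "\<phi> = (\<lambda>x. \<Sum>k\<in>nbrs E (Some i). B (Some i) k *
      (x - sqrt (x * volt V k - (flow E B p (Some i) k)\<^sup>2)))"
    have "closed {x. \<phi> x \<le> q $ i}"
      unfolding \<phi>_def by (intro closed_Collect_le continuous_intros)
    moreover have "A i \<subseteq> {x. \<phi> x \<le> q $ i}"
    proof -
      have "\<phi> (v $ i) \<le> q $ i" if v: "R_feasible E B p q v" for v
      proof -
        have "\<phi> (v $ i) \<le> qmap E B p v $ i"
          unfolding qmap_nth \<phi>_def
          by (intro sum_mono mult_left_mono diff_left_mono real_sqrt_le_mono diff_right_mono)
             (use volt_mono[OF le[OF v]] feasible_pos[OF v] weight_pos in
               \<open>auto intro: less_imp_le\<close>)
        with v show ?thesis by (auto simp: R_feasible_def intro: order_trans)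
      qed
      then show ?thesis by (auto simp: A_def)
    qed
    ultimately have "closure (A i) \<subseteq> {x. \<phi> x \<le> q $ i}" by (simp add: closure_minimal)
    with closure_contains_Sup[OF ne bdd, of i] have "\<phi> (V $ i) \<le> q $ i" by (auto simp: V_def)
    then show ?thesis by (simp add: \<phi>_def qmap_nth)
  qed
  \<comment> \<open>Positivity and nonnegative radicands are inherited from \<open>v0\<close>, which
    lies below \<open>V\<close>.\<close>
  then have "R_feasible E B p q V" by (intro feasible_raise[OF v0 le[OF v0]])
  with le show ?thesis by (auto simp: greatest_feasible_def)
qed

lemma greatest_feasible_no_raise:
  assumes V: "greatest_feasible p q V" and "V \<le> z"
    and "\<And>i. V $ i < z $ i \<Longrightarrow> qmap E B p z $ i \<le> q $ i"
  shows "z = V"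
proof -
  have "R_feasible E B p q V" using V by (simp add: greatest_feasible_def)
  then have "R_feasible E B p q z" by (rule feasible_raise) (use assms in auto)
  then have "z \<le> V" using V by (auto simp: greatest_feasible_def)
  with \<open>V \<le> z\<close> show ?thesis by (simp add: less_eq_vec_def vec_eq_iff order_antisym)
qed

text \<open>Row \<open>i\<close> depends continuously on the voltages, so a sufficiently small
  increase at bus \<open>i\<close> preserves strict slack there, and the other rows do not
  suffer.\<close>

lemma feasible_raise_slack:
  assumes u: "R_feasible E B p q u" and slack: "qmap E B p u $ i < q $ i"
  obtains u' where "R_feasible E B p q u'" "u \<le> u'" "u $ i < u' $ i" "\<And>j. j \<noteq> i \<Longrightarrow> u' $ j = u $ j"
    "qmap E B p u' $ i < q $ i"
proof -
  define z where "z = (\<lambda>t. u + t *\<^sub>R axis i (1::real))"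
  have "((\<lambda>t. z t) \<longlongrightarrow> u + 0 *\<^sub>R axis i 1) (at_right 0)"
    unfolding z_def by (intro tendsto_intros)
  then have "((\<lambda>t. qmap E B p (z t) $ i) \<longlongrightarrow> qmap E B p u $ i) (at_right 0)"
    by (intro tendsto_qmap tendsto_const) simp
  then have "\<forall>\<^sub>F t in at_right 0. qmap E B p (z t) $ i < q $ i"
    using slack by (rule order_tendstoD)
  moreover have "\<forall>\<^sub>F t::real in at_right 0. 0 < t" by (simp add: eventually_at_right_less)
  ultimately have "\<forall>\<^sub>F t in at_right 0. qmap E B p (z t) $ i < q $ i \<and> 0 < t"
    by (rule eventually_conj)
  then obtain t where t: "qmap E B p (z t) $ i < q $ i" "0 < t"
    using eventually_happens'[OF trivial_limit_at_right_real] by blast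
  have le: "u \<le> z t" using t by (simp add: z_def less_eq_vec_def axis_def)
  have other: "z t $ j = u $ j" if "j \<noteq> i" for j using that by (simp add: z_def axis_def)
  show thesis
  proof (rule that[OF _ le _ other t(1)])
    show "R_feasible E B p q (z t)"
      by (rule feasible_raise[OF u le]) (metis other t(1) less_imp_le less_irrefl)
    show "u $ i < z t $ i" using t by (simp add: z_def)
  qed
qed

lemma greatest_feasible_RPF:
  assumes V: "greatest_feasible p q V"
  shows "RPF_solution E B p q V"
  unfolding RPF_solution_def
proof (intro conjI allI)
  have feas: "R_feasible E B p q V" using V by (simp add: greatest_feasible_def)
  then show "qmap_domain E B p V" by (simp add: R_feasible_def)
  fix i
  show "qmap E B p V $ i = q $ i"
  proof (rule ccontr)
    assume "qmap E B p V $ i \<noteq> q $ i"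
    then have "qmap E B p V $ i < q $ i" using feas by (simp add: R_feasible_def order_less_le)
    from feasible_raise_slack[OF feas this] obtain u where
      u: "R_feasible E B p q u" "V $ i < u $ i" by metis
    then have "u $ i \<le> V $ i" using V by (auto simp: greatest_feasible_def less_eq_vec_def)
    with u show False by simp
  qed
qed

lemma R_optimal_iff:
  assumes V: "greatest_feasible p q V" and w: "\<forall>i. 0 < w $ i"
  shows "R_optimal E B w p q v \<longleftrightarrow> v = V"
proof -
  have feas: "R_feasible E B p q V" using V by (simp add: greatest_feasible_def)
  have le: "w $ i * ln (v $ i) \<le> w $ i * ln (V $ i)" if "R_feasible E B p q v" for v i
    using that V w feasible_pos[OF that, of i] feasible_pos[OF feas, of i]
    by (auto simp: greatest_feasible_def less_eq_vec_def intro!: mult_left_mono less_imp_le)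
  show ?thesis
  proof
    assume "v = V"
    then show "R_optimal E B w p q v"
      using feas le by (auto simp: R_optimal_def intro: sum_mono)
  next
    assume opt: "R_optimal E B w p q v"
    then have v: "R_feasible E B p q v" by (simp add: R_optimal_def)
    show "v = V"
    proof (rule ccontr)
      assume "v \<noteq> V"
      then obtain i where "v $ i \<noteq> V $ i" by (auto simp: vec_eq_iff)
      then have "v $ i < V $ i" using v V by (auto simp: greatest_feasible_def less_eq_vec_def order_less_le)
      then have "w $ i * ln (v $ i) < w $ i * ln (V $ i)"
        using w feasible_pos[OF v, of i] by simp
      then have "(\<Sum>i\<in>UNIV. w $ i * ln (v $ i)) < (\<Sum>i\<in>UNIV. w $ i * ln (V $ i))"
        using le[OF v] by (intro sum_strict_mono_ex1) auto
      then show False using opt feas by (force simp: R_optimal_def)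
    qed
  qed
qed

lemma v_opt_eq:
  "greatest_feasible p q V \<Longrightarrow> \<forall>i. 0 < w $ i \<Longrightarrow> v_opt E B w p q = V"
  unfolding v_opt_def by (rule the_equality) (simp_all add: R_optimal_iff)

text \<open>Limits of feasible points satisfy this relaxation, in which some voltages may vanish.\<close>

definition weakly_feasible :: "real^'n \<Rightarrow> real^'n \<Rightarrow> real^'n \<Rightarrow> bool" where
  "weakly_feasible p q v \<longleftrightarrow>
    (\<forall>i. 0 \<le> v $ i) \<and> (\<forall>a. \<forall>b\<in>nbrs E a. (flow E B p a b)\<^sup>2 \<le> volt v a * volt v b) \<and>
    (\<forall>i. qmap E B p v $ i \<le> q $ i)"

lemma R_feasible_iff: "R_feasible E B p q v \<longleftrightarrow> positive_vec v \<and> weakly_feasible p q v"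
  using domain_nbr[of p v]
  by (auto simp: R_feasible_def weakly_feasible_def qmap_domain_def positive_vec_def nbrs_iff
      intro: less_imp_le)

section \<open>Joint convexity of the constraints in injections and voltages\<close>

lemma line_convex:
  assumes 1: "weakly_feasible p q v" and 2: "weakly_feasible p' q' v'"
    and x: "0 \<le> x" and y: "0 \<le> y" and xy: "x + y = 1" and k: "k \<in> nbrs E a"
  defines "vv \<equiv> x *\<^sub>R v + y *\<^sub>R v'" and "pp \<equiv> x *\<^sub>R p + y *\<^sub>R p'"
  shows "(flow E B pp a k)\<^sup>2 \<le> volt vv a * volt vv k"
    and "B a k * (volt vv a - sqrt (volt vv a * volt vv k - (flow E B pp a k)\<^sup>2)) \<le>
      x * (B a k * (volt v a - sqrt (volt v a * volt v k - (flow E B p a k)\<^sup>2))) +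
      y * (B a k * (volt v' a - sqrt (volt v' a * volt v' k - (flow E B p' a k)\<^sup>2)))"
proof -
  \<comment> \<open>At the root this reads \<open>1 = x + y\<close>.\<close>
  have volt: "volt vv b = x * volt v b + y * volt v' b" for b
    using xy by (cases b) (auto simp: vv_def)
  have fl: "flow E B pp a b = x * flow E B p a b + y * flow E B p' a b" for a b
    by (simp add: flow_add flow_scale pp_def)
  have nn: "0 \<le> volt v b" "0 \<le> volt v' b" for b
    using 1 2 by (auto simp: weakly_feasible_def intro!: volt_nonneg)
  have dom: "(flow E B p a k)\<^sup>2 \<le> volt v a * volt v k" "(flow E B p' a k)\<^sup>2 \<le> volt v' a * volt v' k"
    using 1 2 k by (auto simp: weakly_feasible_def)
  note conc = edge_concave[OF nn(1) nn(1) nn(2) nn(2) dom x y]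
  show "(flow E B pp a k)\<^sup>2 \<le> volt vv a * volt vv k"
    unfolding volt fl by (rule conc(1))
  have "B a k * (volt vv a - sqrt (volt vv a * volt vv k - (flow E B pp a k)\<^sup>2)) \<le>
      B a k * (volt vv a - (x * sqrt (volt v a * volt v k - (flow E B p a k)\<^sup>2) +
        y * sqrt (volt v' a * volt v' k - (flow E B p' a k)\<^sup>2)))"
    using conc(2) weight_pos[OF k] unfolding volt fl by (intro mult_left_mono) auto
  then show "B a k * (volt vv a - sqrt (volt vv a * volt vv k - (flow E B pp a k)\<^sup>2)) \<le>
      x * (B a k * (volt v a - sqrt (volt v a * volt v k - (flow E B p a k)\<^sup>2))) +
      y * (B a k * (volt v' a - sqrt (volt v' a * volt v' k - (flow E B p' a k)\<^sup>2)))"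
    by (simp add: volt algebra_simps)
qed

lemma qmap_convex:
  assumes "weakly_feasible p q v" "weakly_feasible p' q' v'" "0 \<le> x" "0 \<le> y" "x + y = 1"
  shows "qmap E B (x *\<^sub>R p + y *\<^sub>R p') (x *\<^sub>R v + y *\<^sub>R v') $ i \<le>
    x * qmap E B p v $ i + y * qmap E B p' v' $ i"
  unfolding qmap_nth sum_distrib_left sum.distrib[symmetric]
  by (rule sum_mono) (use line_convex(2)[OF assms, of _ "Some i"] in simp)

lemma weakly_feasible_convex:
  assumes 1: "weakly_feasible p q v" and 2: "weakly_feasible p' q' v'"
    and x: "0 \<le> x" and y: "0 \<le> y" and xy: "x + y = 1"
  shows "weakly_feasible (x *\<^sub>R p + y *\<^sub>R p') (x *\<^sub>R q + y *\<^sub>R q') (x *\<^sub>R v + y *\<^sub>R v')"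
  unfolding weakly_feasible_def
proof (intro conjI allI ballI)
  fix i
  show "0 \<le> (x *\<^sub>R v + y *\<^sub>R v') $ i" using 1 2 x y by (simp add: weakly_feasible_def)
  have "x * qmap E B p v $ i + y * qmap E B p' v' $ i \<le> x * q $ i + y * q' $ i"
    using 1 2 x y by (intro add_mono mult_left_mono) (auto simp: weakly_feasible_def)
  with qmap_convex[OF assms, of i]
  show "qmap E B (x *\<^sub>R p + y *\<^sub>R p') (x *\<^sub>R v + y *\<^sub>R v') $ i \<le> (x *\<^sub>R q + y *\<^sub>R q') $ i" by simp
qed (rule line_convex(1)[OF assms])

lemma feasible_convex:
  assumes "R_feasible E B p q v" "R_feasible E B p' q' v'"
    and x: "0 \<le> x" and y: "0 \<le> y" and xy: "x + y = 1"
  shows "R_feasible E B (x *\<^sub>R p + y *\<^sub>R p') (x *\<^sub>R q + y *\<^sub>R q') (x *\<^sub>R v + y *\<^sub>R v')"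
proof -
  have "0 < (x *\<^sub>R v + y *\<^sub>R v') $ i" for i
    using feasible_pos[OF assms(1), of i] feasible_pos[OF assms(2), of i] x y xy
    by (cases "x = 0") (auto intro: add_pos_nonneg mult_pos_pos)
  with assms show ?thesis
    by (simp add: R_feasible_iff weakly_feasible_convex positive_vec_def)
qed

lemma convex_feasible_set: "convex (feasible_set E B)"
  unfolding convex_def
proof (intro ballI allI impI)
  fix X Y and x y :: real
  assume XY: "X \<in> feasible_set E B" "Y \<in> feasible_set E B" and xy: "0 \<le> x" "0 \<le> y" "x + y = 1"
  then obtain p q v p' q' v' where "X = (p, q)" "R_feasible E B p q v"
      "Y = (p', q')" "R_feasible E B p' q' v'"
    by (auto simp: feasible_set_def)
  with feasible_convex[OF _ _ xy, of p q v p' q' v']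
  show "x *\<^sub>R X + y *\<^sub>R Y \<in> feasible_set E B"
    by (auto simp: feasible_set_def)
qed

text \<open>A vanishing radicand can be opened up by raising both ends of the line: the square root
  gains \<open>sqrt t\<close> while the linear term costs only \<open>t\<close>.\<close>

lemma greatest_feasible_radicand_pos:
  assumes V: "greatest_feasible p q V" and nb: "b \<in> nbrs E a"
  shows "(flow E B p a b)\<^sup>2 < volt V a * volt V b"
proof (rule ccontr)
  assume "\<not> ?thesis"
  have feas: "R_feasible E B p q V" using V by (simp add: greatest_feasible_def)
  then have dom: "qmap_domain E B p V" by (simp add: R_feasible_def)
  have vp: "0 < volt V a" for a using dom volt_pos by (auto simp: qmap_domain_def)
  have nba: "a \<in> nbrs E b" using nb nbrs_sym by blast
  have ab: "a \<noteq> b" using nb nbrs_irrefl by auto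
  from \<open>\<not> ?thesis\<close> have zero: "volt V a * volt V b - (flow E B p a b)\<^sup>2 = 0"
    using domain_nbr[OF dom nb] by simp
  \<comment> \<open>The bound is chosen so that \<open>t \<le> r c d\<close> says
    \<open>Btot E B c * t \<le> B c d * sqrt (t * volt V d)\<close>: the linear cost at
    \<open>c\<close> is at most the gain on the line to \<open>d\<close>.\<close>
  define r where "r = (\<lambda>c d. (B c d / Btot E B c)\<^sup>2 * volt V d)"
  define t where "t = min (r a b) (r b a)"
  \<comment> \<open>If one end is the root, only the other end is raised, since no
    \<open>Some i\<close> equals \<open>None\<close>.\<close>
  define z where "z = (\<chi> i. V $ i + (if Some i = a \<or> Some i = b then t else 0))"
  have "0 < r a b" "0 < r b a"
    using weight_pos[OF nb] weight_pos[OF nba] Btot_pos[OF nb] Btot_pos[OF nba] vp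
    by (auto simp: r_def intro!: mult_pos_pos zero_less_power divide_pos_pos)
  then have t: "0 < t" "t \<le> r a b" "t \<le> r b a" by (auto simp: t_def)
  have le: "V \<le> z" using t by (simp add: z_def less_eq_vec_def)
  have raise: "qmap E B p z $ i \<le> q $ i"
    if c: "Some i = c" and nd: "d \<in> nbrs E c" and cd: "{c, d} = {a, b}" and tr: "t \<le> r c d" for i c d
  proof -
    have zc: "z $ i = V $ i + t" using c cd by (auto simp: z_def doubleton_eq_iff)
    have zero': "V $ i * volt V d - (flow E B p c d)\<^sup>2 = 0"
      using cd zero c flow_sq_sym[of p a b] by (auto simp: doubleton_eq_iff mult.commute)
    have Bt: "0 < Btot E B c" using nd by (rule Btot_pos)
    have mono: "V $ i * volt V k \<le> z $ i * volt z k" for k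
      using volt_mono[OF le, of k] vp[of k] feasible_pos[OF feas, of i] zc t by (intro mult_mono) auto
    let ?g = "\<lambda>v k. sqrt (v $ i * volt v k - (flow E B p (Some i) k)\<^sup>2)"
    have gd: "sqrt (t * volt V d) \<le> ?g z d"
    proof (rule real_sqrt_le_mono)
      have "t * volt V d + V $ i * volt V d \<le> z $ i * volt z d"
        using volt_mono[OF le, of d] vp[of d] feasible_pos[OF feas, of i] zc t
          mult_left_mono[OF volt_mono[OF le, of d], of "V $ i + t"]
        by (simp add: algebra_simps)
      with zero' c show "t * volt V d \<le> z $ i * volt z d - (flow E B p (Some i) d)\<^sup>2" by simp
    qed
    have "(Btot E B c * t)\<^sup>2 \<le> (B c d)\<^sup>2 * (t * volt V d)"
    proof -
      have "(Btot E B c)\<^sup>2 * t * t \<le> (Btot E B c)\<^sup>2 * t * r c d"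
        using tr t by (intro mult_left_mono) auto
      also have "\<dots> = (B c d)\<^sup>2 * (t * volt V d)"
        using Bt by (simp add: r_def power_divide field_simps)
      finally show ?thesis by (simp add: power2_eq_square algebra_simps)
    qed
    then have "Btot E B c * t \<le> sqrt ((B c d)\<^sup>2 * (t * volt V d))" by (rule real_le_rsqrt)
    also have "\<dots> = B c d * sqrt (t * volt V d)"
      using weight_pos[OF nd] by (simp add: real_sqrt_mult)
    also have "\<dots> \<le> B c d * ?g z d"
      using gd weight_pos[OF nd] by (intro mult_left_mono) auto
    finally have key: "Btot E B c * t \<le> B c d * ?g z d" .
    have nd': "d \<in> nbrs E (Some i)" using nd c by simp
    have "B (Some i) d * ?g z d + (\<Sum>k\<in>nbrs E (Some i) - {d}. B (Some i) k * ?g V k) \<le>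
        (\<Sum>k\<in>nbrs E (Some i). B (Some i) k * ?g z k)"
      unfolding sum.remove[OF finite nd', of "\<lambda>k. B (Some i) k * ?g z k"]
      by (intro add_left_mono sum_mono mult_left_mono real_sqrt_le_mono diff_right_mono mono)
         (use weight_pos in \<open>auto intro: less_imp_le\<close>)
    moreover have "(\<Sum>k\<in>nbrs E (Some i). B (Some i) k * ?g V k) =
        (\<Sum>k\<in>nbrs E (Some i) - {d}. B (Some i) k * ?g V k)"
      unfolding sum.remove[OF finite nd', of "\<lambda>k. B (Some i) k * ?g V k"] using zero' c by simp
    ultimately have "qmap E B p z $ i \<le> qmap E B p V $ i"
      using key c zc by (simp add: qmap_def algebra_simps)
    also have "\<dots> \<le> q $ i" using feas by (simp add: R_feasible_def)
    finally show ?thesis .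
  qed
  have "z = V"
  proof (rule greatest_feasible_no_raise[OF V le])
    fix i assume "V $ i < z $ i"
    then consider "Some i = a" | "Some i = b" by (auto simp: z_def split: if_splits)
    then show "qmap E B p z $ i \<le> q $ i"
    proof cases
      case 1
      show ?thesis by (rule raise[OF 1 nb _ t(2)]) simp
    next
      case 2
      show ?thesis by (rule raise[OF 2 nba _ t(3)]) auto
    qed
  qed
  moreover obtain i where "Some i = a \<or> Some i = b" using ab by (cases a; cases b) auto
  ultimately show False using t by (auto simp: z_def vec_eq_iff split: if_splits)
qed

end

section \<open>Continuity\<close>

lemma sqrt_midpoint_less:
  fixes a b :: real
  assumes "0 \<le> a" "0 \<le> b" "a \<noteq> b"
  shows "sqrt a / 2 + sqrt b / 2 < sqrt (a / 2 + b / 2)"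
proof (rule real_less_rsqrt)
  have "sqrt a \<noteq> sqrt b" using assms by simp
  then have "0 < (sqrt a - sqrt b)\<^sup>2" by simp
  also have "\<dots> = 4 * (a / 2 + b / 2) - 4 * (sqrt a / 2 + sqrt b / 2)\<^sup>2"
    using assms by (simp add: power2_eq_square algebra_simps)
  finally show "(sqrt a / 2 + sqrt b / 2)\<^sup>2 < a / 2 + b / 2" by simp
qed

lemma not_eventually_sequentially_subseq:
  assumes "\<not> (\<forall>\<^sub>F n in sequentially. P n)"
  obtains r :: "nat \<Rightarrow> nat" where "strict_mono r" "\<And>n. \<not> P (r n)"
proof -
  have "infinite {n. \<not> P n}"
    using assms by (simp add: cofinite_eq_sequentially[symmetric] eventually_cofinite)
  then show thesis using infinite_enumerate that by blast
qed

context tree_network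
begin

lemma weakly_feasible_limit:
  assumes P: "P \<longlonglongrightarrow> p" and Q: "Q \<longlonglongrightarrow> q" and W: "W \<longlonglongrightarrow> v"
    and feas: "\<And>n. R_feasible E B (P n) (Q n) (W n)"
  shows "weakly_feasible p q v"
proof -
  have wf: "weakly_feasible (P n) (Q n) (W n)" for n using feas by (simp add: R_feasible_iff)
  show ?thesis
    unfolding weakly_feasible_def
  proof (intro conjI allI ballI)
    fix i
    show "0 \<le> v $ i"
      by (rule LIMSEQ_le_const[OF tendsto_vec_nth[OF W]]) (use wf in \<open>auto simp: weakly_feasible_def\<close>)
    show "qmap E B p v $ i \<le> q $ i"
      by (rule LIMSEQ_le[OF tendsto_qmap[OF P W] tendsto_vec_nth[OF Q]])
         (use wf in \<open>auto simp: weakly_feasible_def\<close>)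
  next
    fix a b assume "b \<in> nbrs E a"
    then show "(flow E B p a b)\<^sup>2 \<le> volt v a * volt v b"
      by (intro LIMSEQ_le[OF tendsto_power[OF tendsto_flow[OF P]]
            tendsto_mult[OF tendsto_volt[OF W] tendsto_volt[OF W]]])
         (use wf in \<open>auto simp: weakly_feasible_def\<close>)
  qed
qed

text \<open>Joint concavity is not strict: with zero flow, \<open>sqrt (x * y)\<close> is linear
  along rays. On a line whose other end has the same voltage in both points, however, the radicand
  is a nonconstant affine function of \<open>v $ i\<close>, and strict concavity of
  \<open>sqrt\<close> applies. The remaining lines are handled by
  \<open>line_convex\<close>.\<close>

lemma qmap_midpoint_strict:
  assumes v: "weakly_feasible p q v" and V: "weakly_feasible p q V"
    and k: "k \<in> nbrs E (Some i)" "volt v k = volt V k" "0 < volt V k" and i: "v $ i \<noteq> V $ i"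
  shows "qmap E B p ((1/2) *\<^sub>R v + (1/2) *\<^sub>R V) $ i < q $ i"
proof -
  let ?M = "(1/2) *\<^sub>R v + (1/2) *\<^sub>R V"
  let ?t = "\<lambda>v k. B (Some i) k * (v $ i - sqrt (v $ i * volt v k - (flow E B p (Some i) k)\<^sup>2))"
  have pp: "(1/2) *\<^sub>R p + (1/2) *\<^sub>R p = p" by (simp add: vec_eq_iff)
  have "(\<Sum>k\<in>nbrs E (Some i). ?t ?M k) < (\<Sum>k\<in>nbrs E (Some i). 1/2 * ?t v k + 1/2 * ?t V k)"
  proof (rule sum_strict_mono_ex1)
    show "\<forall>k\<in>nbrs E (Some i). ?t ?M k \<le> 1/2 * ?t v k + 1/2 * ?t V k"
      using line_convex(2)[OF v V, of "1/2" "1/2" _ "Some i"] unfolding pp by simp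
    have "?t ?M k < 1/2 * ?t v k + 1/2 * ?t V k"
    proof -
      define s where "s = (flow E B p (Some i) k)\<^sup>2"
      have vk: "volt ?M k = volt V k" using k(2) by (cases k) auto
      have "s \<le> v $ i * volt V k" "s \<le> V $ i * volt V k"
        using v V k by (auto simp: weakly_feasible_def s_def dest!: spec[of _ "Some i"])
      moreover have "v $ i * volt V k - s \<noteq> V $ i * volt V k - s" using k i by simp
      ultimately have "sqrt (v $ i * volt V k - s) / 2 + sqrt (V $ i * volt V k - s) / 2 <
          sqrt ((v $ i * volt V k - s) / 2 + (V $ i * volt V k - s) / 2)"
        by (intro sqrt_midpoint_less) auto
      also have "(v $ i * volt V k - s) / 2 + (V $ i * volt V k - s) / 2 = ?M $ i * volt V k - s"
        by (simp add: field_simps)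
      finally have "B (Some i) k * (?M $ i - sqrt (?M $ i * volt V k - s)) < B (Some i) k * (?M $ i -
          (sqrt (v $ i * volt V k - s) / 2 + sqrt (V $ i * volt V k - s) / 2))"
        using weight_pos[OF k(1)] by (intro mult_strict_left_mono diff_strict_left_mono)
      also have "\<dots> = 1/2 * ?t v k + 1/2 * ?t V k"
        by (simp add: k(2) s_def field_simps)
      finally show ?thesis by (simp only: vk s_def)
    qed
    with k(1) show "\<exists>k\<in>nbrs E (Some i). ?t ?M k < 1/2 * ?t v k + 1/2 * ?t V k" by blast
  qed simp
  also have "\<dots> = 1/2 * qmap E B p v $ i + 1/2 * qmap E B p V $ i"
    by (simp add: qmap_nth sum.distrib sum_distrib_left)
  also have "\<dots> \<le> q $ i"
  proof -
    have "qmap E B p v $ i \<le> q $ i" "qmap E B p V $ i \<le> q $ i"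
      using v V by (auto simp: weakly_feasible_def)
    then show ?thesis by simp
  qed
  finally show ?thesis by (simp add: qmap_nth)
qed

text \<open>Wherever \<open>v < V\<close>, the midpoint of \<open>v\<close> and \<open>V\<close> can be raised to a point with slack: slack
  appears by strict concavity at the buses next to one where \<open>v = V\<close>, and raising a bus with slack
  creates slack at its neighbours.\<close>

lemma exists_slack_point:
  assumes v: "weakly_feasible p q v" and V: "greatest_feasible p q V" and "v \<le> V"
  obtains u where "R_feasible E B p q u" "(1/2) *\<^sub>R v + (1/2) *\<^sub>R V \<le> u"
    "\<And>i. v $ i < V $ i \<Longrightarrow> qmap E B p u $ i < q $ i"
proof -
  let ?M = "(1/2) *\<^sub>R v + (1/2) *\<^sub>R V"
  define S where "S = (\<lambda>u. {i. qmap E B p u $ i < q $ i})"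
  define G where "G = (\<lambda>u. R_feasible E B p q u \<and> ?M \<le> u \<and> S ?M \<subseteq> S u)"
  have feasV: "R_feasible E B p q V" using V by (simp add: greatest_feasible_def)
  then have wV: "weakly_feasible p q V" by (simp add: R_feasible_iff)
  have half: "(1/2) *\<^sub>R x + (1/2) *\<^sub>R x = x" for x :: "real^'n" by (simp add: vec_eq_iff)
  have "weakly_feasible p q ?M"
    using weakly_feasible_convex[OF v wV, of "1/2" "1/2"] unfolding half by simp
  moreover have "positive_vec ?M"
    unfolding positive_vec_def
  proof
    fix i
    have "0 \<le> v $ i" "0 < V $ i" using v feasible_pos[OF feasV] by (auto simp: weakly_feasible_def)
    then show "0 < ?M $ i" by simp
  qed
  ultimately have "G ?M" by (auto simp: G_def R_feasible_iff)
  moreover have "\<forall>u. G u \<longrightarrow> card (S u) < Suc CARD('n)"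
    by (simp add: less_Suc_eq_le card_mono)
  \<comment> \<open>A point with the largest number of slack buses replaces an iterated raising: any
    step that created a new slack bus while keeping the old ones would contradict this
    choice.\<close>
  ultimately obtain u where u: "G u" and max: "\<And>u'. G u' \<Longrightarrow> card (S u') \<le> card (S u)"
    using ex_has_greatest_nat[of G ?M "\<lambda>u. card (S u)"] by blast
  have feas: "R_feasible E B p q u" using u by (simp add: G_def)
  have "case b of None \<Rightarrow> True | Some i \<Rightarrow> v $ i < V $ i \<longrightarrow> i \<in> S u" for b
  proof (induction b rule: tree_induct)
    case (edge a b)
    obtain k where b: "b = Some k" using edge.hyps root_no_parent by (cases b) auto
    have nb: "a \<in> nbrs E (Some k)" using edge.hyps b by (simp add: nbrs_iff)
    \<comment> \<open>If the parent has equal voltages in \<open>v\<close> and \<open>V\<close>, as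
      the root does, slack is already present at the midpoint. Otherwise the parent has slack by
      induction, and raising it gives slack to \<open>k\<close>.\<close>
    have "k \<in> S u" if k: "v $ k < V $ k"
    proof (cases "volt v a = volt V a")
      case True
      have "0 < volt V a" using volt_pos feasV by (auto simp: R_feasible_def qmap_domain_def)
      then have "k \<in> S ?M"
        using qmap_midpoint_strict[OF v wV nb True] k by (simp add: S_def)
      then show ?thesis using u by (auto simp: G_def)
    next
      case False
      then obtain i where a: "a = Some i" and "v $ i \<noteq> V $ i" by (cases a) auto
      then have "v $ i < V $ i" using \<open>v \<le> V\<close> by (auto simp: less_eq_vec_def order_less_le)
      with edge.IH a have iS: "i \<in> S u" by simp
      then have "qmap E B p u $ i < q $ i" by (simp add: S_def)
      from feasible_raise_slack[OF feas this] obtain u' where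
        u': "R_feasible E B p q u'" "u \<le> u'" "u $ i < u' $ i" "\<And>j. j \<noteq> i \<Longrightarrow> u' $ j = u $ j"
          "qmap E B p u' $ i < q $ i" by metis
      have "l \<in> S u'" if l: "l \<in> S u" for l
      proof (cases "l = i")
        case False
        then have "qmap E B p u' $ l \<le> qmap E B p u $ l"
          using u' feasible_pos[OF feas, of l] by (intro qmap_mono) auto
        with l show ?thesis by (simp add: S_def)
      qed (use u' in \<open>simp add: S_def\<close>)
      then have sub: "S u \<subseteq> S u'" by blast
      with u u' have "G u'" by (auto simp: G_def)
      have "i \<noteq> k" using nb a nbrs_irrefl by auto
      then have "qmap E B p u' $ k < qmap E B p u $ k"
        using u' nb a feasible_pos[OF feas, of k] by (intro qmap_strict_mono[where j = i]) auto
      also have "\<dots> \<le> q $ k" using feas by (simp add: R_feasible_def)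
      finally have "k \<in> S u'" by (simp add: S_def)
      show ?thesis
      proof (rule ccontr)
        assume "k \<notin> S u"
        with sub \<open>k \<in> S u'\<close> have "S u \<subset> S u'" by blast
        then have "card (S u) < card (S u')" by (intro psubset_card_mono) auto
        with max[OF \<open>G u'\<close>] show False by simp
      qed
    qed
    with b show ?case by simp
  qed simp
  from this[of "Some _"] show thesis
    by (intro that[of u]) (use u in \<open>auto simp: G_def S_def\<close>)
qed

lemma greatest_feasible_limit:
  assumes P: "P \<longlonglongrightarrow> p" and Q: "Q \<longlonglongrightarrow> q" and W: "W \<longlonglongrightarrow> v"
    and gr: "\<And>n. greatest_feasible (P n) (Q n) (W n)" and V: "greatest_feasible p q V"
  shows "v = V"
proof (rule ccontr)
  assume "v \<noteq> V"
  have feas: "R_feasible E B (P n) (Q n) (W n)" for n using gr by (simp add: greatest_feasible_def)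
  have feasV: "R_feasible E B p q V" using V by (simp add: greatest_feasible_def)
  have v: "weakly_feasible p q v" by (rule weakly_feasible_limit[OF P Q W feas])
  have "R_feasible E B p q (\<chi> i. max (v $ i) (V $ i))"
    by (rule feasible_max[OF feasV]) (use v in \<open>auto simp: weakly_feasible_def\<close>)
  then have vV: "v \<le> V" using V by (fastforce simp: greatest_feasible_def less_eq_vec_def)
  from exists_slack_point[OF v V this] obtain u where
    u: "R_feasible E B p q u" "(1/2) *\<^sub>R v + (1/2) *\<^sub>R V \<le> u"
      "\<And>i. v $ i < V $ i \<Longrightarrow> qmap E B p u $ i < q $ i" by metis
  have Mu: "v $ i / 2 + V $ i / 2 \<le> u $ i" for i using u(2) by (simp add: less_eq_vec_def)
  have uV: "u $ i \<le> V $ i" for i using u(1) V by (auto simp: greatest_feasible_def less_eq_vec_def)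
  define T where "T = {i. v $ i < V $ i}"
  have T: "v $ i < u $ i" if "i \<in> T" for i using that Mu[of i] by (simp add: T_def)
  \<comment> \<open>Outside \<open>T\<close> the midpoint and \<open>V\<close> coincide, and
    \<open>u\<close> lies between them.\<close>
  have notT: "u $ i = v $ i" if "i \<notin> T" for i
  proof -
    have "v $ i = V $ i" using that vV by (auto simp: T_def less_eq_vec_def order_less_le)
    then show ?thesis using Mu[of i] uV[of i] by simp
  qed
  obtain i0 where i0: "i0 \<in> T"
    using \<open>v \<noteq> V\<close> vV by (auto simp: T_def vec_eq_iff less_eq_vec_def order_less_le)
  \<comment> \<open>Only buses in \<open>T\<close> are raised above \<open>W n\<close>, so only
    their rows are tested. Since \<open>z\<close> tends to \<open>u\<close>, the strict slack of
    \<open>u\<close> on \<open>T\<close> persists for large \<open>n\<close>.\<close>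
  define z where "z = (\<lambda>n. \<chi> i. if i \<in> T then max (W n $ i) (u $ i) else W n $ i)"
  have z: "z \<longlonglongrightarrow> u"
  proof (rule vec_tendstoI)
    fix i
    show "(\<lambda>n. z n $ i) \<longlonglongrightarrow> u $ i"
    proof (cases "i \<in> T")
      case True
      have "(\<lambda>n. max (W n $ i) (u $ i)) \<longlonglongrightarrow> max (v $ i) (u $ i)"
        by (intro tendsto_intros W)
      with True T[OF True] show ?thesis by (simp add: z_def max_def)
    next
      case False
      with tendsto_vec_nth[OF W, of i] notT[OF False] show ?thesis by (simp add: z_def)
    qed
  qed
  have ev: "\<forall>\<^sub>F n in sequentially. W n $ i < u $ i \<and> qmap E B (P n) (z n) $ i < Q n $ i" if "i \<in> T" for i
  proof (rule eventually_conj)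
    show "\<forall>\<^sub>F n in sequentially. W n $ i < u $ i"
      using tendsto_vec_nth[OF W] T[OF that] by (rule order_tendstoD)
    have "(\<lambda>n. Q n $ i - qmap E B (P n) (z n) $ i) \<longlonglongrightarrow> q $ i - qmap E B p u $ i"
      by (intro tendsto_diff tendsto_vec_nth[OF Q] tendsto_qmap[OF P z])
    then have "\<forall>\<^sub>F n in sequentially. 0 < Q n $ i - qmap E B (P n) (z n) $ i"
      by (rule order_tendstoD) (use u(3) that in \<open>simp add: T_def\<close>)
    then show "\<forall>\<^sub>F n in sequentially. qmap E B (P n) (z n) $ i < Q n $ i" by simp
  qed
  have "\<forall>\<^sub>F n in sequentially. \<forall>i\<in>T. W n $ i < u $ i \<and> qmap E B (P n) (z n) $ i < Q n $ i"
    by (rule eventually_ball_finite) (use ev in auto)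
  then obtain n where n: "\<And>i. i \<in> T \<Longrightarrow> W n $ i < u $ i \<and> qmap E B (P n) (z n) $ i < Q n $ i"
    using eventually_happens'[OF sequentially_bot] by blast
  have "z n = W n"
  proof (rule greatest_feasible_no_raise[OF gr])
    show "W n \<le> z n" by (simp add: z_def less_eq_vec_def)
    fix i assume "W n $ i < z n $ i"
    then have "i \<in> T" by (auto simp: z_def split: if_splits)
    with n show "qmap E B (P n) (z n) $ i \<le> Q n $ i" by (simp add: less_imp_le)
  qed
  then have "z n $ i0 = W n $ i0" by simp
  with i0 n[OF i0] show False by (simp add: z_def)
qed

text \<open>Along convergent data the greatest points lie in one compact box. A subsequence staying
  away from the expected value would have a convergent subsequence, whose limit
  \<open>greatest_feasible_limit\<close> identifies with that very value.\<close>

lemma continuous_on_greatest_feasible: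
  assumes V: "\<And>p q. (p, q) \<in> feasible_set E B \<Longrightarrow> greatest_feasible p q (V p q)"
  shows "continuous_on (feasible_set E B) (\<lambda>(p, q). V p q)"
proof (rule continuous_on_sequentiallyI)
  fix X :: "nat \<Rightarrow> (real^'n) \<times> (real^'n)" and a
  assume X: "\<forall>n. X n \<in> feasible_set E B" and a: "a \<in> feasible_set E B" and lim: "X \<longlonglongrightarrow> a"
  define P Q W where "P = (\<lambda>n. fst (X n))" and "Q = (\<lambda>n. snd (X n))" and "W = (\<lambda>n. V (P n) (Q n))"
  have P: "P \<longlonglongrightarrow> fst a" and Q: "Q \<longlonglongrightarrow> snd a"
    unfolding P_def Q_def by (intro tendsto_intros lim)+
  have gr: "greatest_feasible (P n) (Q n) (W n)" for n
    using X V[of "P n" "Q n"] by (simp add: P_def Q_def W_def)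
  have gra: "greatest_feasible (fst a) (snd a) (V (fst a) (snd a))" using V a by simp
  have "Bseq (\<lambda>n. \<Sum>i\<in>UNIV. \<bar>Q n $ i\<bar>)"
    by (intro convergent_imp_Bseq convergentI[of _ "\<Sum>i\<in>UNIV. \<bar>snd a $ i\<bar>"] tendsto_intros Q)
  then obtain M where "\<And>n. norm (\<Sum>i\<in>UNIV. \<bar>Q n $ i\<bar>) \<le> M" by (auto simp: Bseq_def)
  then have M: "(\<Sum>i\<in>UNIV. \<bar>Q n $ i\<bar>) \<le> M" for n by (metis abs_le_D1 real_norm_def)
  obtain K where K: "\<And>p q v i. R_feasible E B p q v \<Longrightarrow> (\<Sum>i\<in>UNIV. \<bar>q $ i\<bar>) \<le> M \<Longrightarrow> v $ i \<le> K"
    using feasible_bound by metis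
  have box: "W n \<in> cbox 0 (\<chi> i. K)" for n
  proof -
    have feas: "R_feasible E B (P n) (Q n) (W n)" using gr by (simp add: greatest_feasible_def)
    then show ?thesis
      using K[OF feas M] feasible_pos[OF feas] by (auto simp: mem_box_cart intro: less_imp_le)
  qed
  have "W \<longlonglongrightarrow> V (fst a) (snd a)"
  proof (rule ccontr)
    assume "\<not> ?thesis"
    then obtain e where "0 < e" and "\<not> (\<forall>\<^sub>F n in sequentially. dist (W n) (V (fst a) (snd a)) < e)"
      by (auto simp: tendsto_iff)
    then obtain r :: "nat \<Rightarrow> nat" where r: "strict_mono r"
      "\<And>n. \<not> dist (W (r n)) (V (fst a) (snd a)) < e"
      using not_eventually_sequentially_subseq by metis
    obtain l r' where r': "strict_mono (r' :: nat \<Rightarrow> nat)" and l: "((W \<circ> r) \<circ> r') \<longlonglongrightarrow> l"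
      using compact_cbox[of 0 "\<chi> i. K"] box unfolding compact_def by (metis comp_apply)
    have sub: "strict_mono (r \<circ> r')" using r r' by (simp add: strict_mono_o)
    have "l = V (fst a) (snd a)"
    proof (rule greatest_feasible_limit[OF _ _ l _ gra])
      show "(P \<circ> (r \<circ> r')) \<longlonglongrightarrow> fst a" "(Q \<circ> (r \<circ> r')) \<longlonglongrightarrow> snd a"
        using LIMSEQ_subseq_LIMSEQ[OF P sub] LIMSEQ_subseq_LIMSEQ[OF Q sub] by auto
    qed (simp add: gr)
    then have "\<forall>\<^sub>F n in sequentially. dist (W (r (r' n))) (V (fst a) (snd a)) < e"
      using l \<open>0 < e\<close> by (auto simp: tendsto_iff)
    then show False using r(2) by simp
  qed
  then show "(\<lambda>n. case X n of (p, q) \<Rightarrow> V p q) \<longlonglongrightarrow> (case a of (p, q) \<Rightarrow> V p q)"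
    by (simp add: W_def P_def Q_def split_def)
qed

end

section \<open>Stability and sensitivity\<close>

lemma symmetric_matrix_inner:
  fixes A :: "real^'n^'n"
  assumes "transpose A = A"
  shows "x \<bullet> (A *v y) = y \<bullet> (A *v x)"
  by (metis assms dot_lmul_matrix inner_commute transpose_matrix_vector)

lemma quadratic_form_expand:
  fixes A :: "real^'n^'n"
  assumes "transpose A = A"
  shows "(x + t *\<^sub>R y) \<bullet> (A *v (x + t *\<^sub>R y)) =
    x \<bullet> (A *v x) + 2 * t * (y \<bullet> (A *v x)) + t\<^sup>2 * (y \<bullet> (A *v y))"
  using symmetric_matrix_inner[OF assms, of x y]
  by (simp add: matrix_vector_right_distrib matrix_vector_mult_scaleR inner_add_left inner_add_right
      power2_eq_square algebra_simps)

text \<open>At \<open>x + t *\<^sub>R (A *v x)\<close> the form has no constant term, so a nonzero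
  linear coefficient would make it negative for small negative \<open>t\<close>.\<close>

lemma positive_semidefinite_kernel:
  assumes A: "positive_semidefinite A" and x: "x \<bullet> (A *v x) = 0"
  shows "A *v x = 0"
proof -
  define y where "y = A *v x"
  define g where "g = y \<bullet> (A *v y)"
  \<comment> \<open>This minimises the quadratic with \<open>g\<close> enlarged to
    \<open>g + 1\<close>, which keeps the denominator positive even if \<open>g = 0\<close>.\<close>
  define t where "t = - (y \<bullet> y) / (g + 1)"
  have sym: "transpose A = A" and nn: "\<And>z. 0 \<le> z \<bullet> (A *v z)"
    using A by (auto simp: positive_semidefinite_def)
  have g: "0 \<le> g" using nn by (simp add: g_def)
  have "0 \<le> 2 * t * (y \<bullet> y) + t\<^sup>2 * g"
    using nn[of "x + t *\<^sub>R y"] unfolding quadratic_form_expand[OF sym] x g_def y_def by simp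
  also have "\<dots> \<le> 2 * t * (y \<bullet> y) + t\<^sup>2 * (g + 1)"
    by (intro add_left_mono mult_left_mono) auto
  also have "\<dots> = 2 * t * (y \<bullet> y) + t * (t * (g + 1))" by (simp add: power2_eq_square)
  also have tg: "t * (g + 1) = - (y \<bullet> y)" using g by (simp add: t_def)
  finally have "0 \<le> t * (y \<bullet> y)" by simp
  then have "0 \<le> t * (y \<bullet> y) * (g + 1)" by (rule mult_nonneg_nonneg) (use g in simp)
  also have "\<dots> = (y \<bullet> y) * (t * (g + 1))" by simp
  also have "\<dots> = - (y \<bullet> y)\<^sup>2" unfolding tg by (simp add: power2_eq_square)
  finally have "(y \<bullet> y)\<^sup>2 \<le> 0" by simp
  then show ?thesis by (simp add: y_def)
qed

definition z_matrix :: "real^'n^'n \<Rightarrow> bool" where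
  "z_matrix A \<longleftrightarrow> (\<forall>i j. i \<noteq> j \<longrightarrow> A $ i $ j \<le> 0)"

lemma quadratic_form_sum: "x \<bullet> (A *v y) = (\<Sum>i\<in>UNIV. \<Sum>j\<in>UNIV. x $ i * A $ i $ j * y $ j)"
  for A :: "real^'n^'n"
  by (simp add: inner_vec_def matrix_vector_mult_def sum_distrib_left mult.assoc)

text \<open>Diagonal terms are unaffected, and each nonpositive off-diagonal entry then meets a
  larger product. Consequently minimisers and null vectors can be chosen nonnegative.\<close>

lemma z_matrix_abs:
  assumes "z_matrix A"
  shows "(\<chi> i. \<bar>x $ i\<bar>) \<bullet> (A *v (\<chi> i. \<bar>x $ i\<bar>)) \<le> x \<bullet> (A *v x)"
  unfolding quadratic_form_sum
proof (intro sum_mono)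
  fix i j
  show "(\<chi> i. \<bar>x $ i\<bar>) $ i * A $ i $ j * (\<chi> i. \<bar>x $ i\<bar>) $ j \<le> x $ i * A $ i $ j * x $ j"
  proof (cases "i = j")
    case True
    have "\<bar>x $ j\<bar> * A $ j $ j * \<bar>x $ j\<bar> = A $ j $ j * \<bar>x $ j * x $ j\<bar>" by (simp add: abs_mult mult_ac)
    with True show ?thesis by (simp add: mult_ac)
  next
    case False
    then have "A $ i $ j * \<bar>x $ i * x $ j\<bar> \<le> A $ i $ j * (x $ i * x $ j)"
      using assms by (intro mult_left_mono_neg) (auto simp: z_matrix_def)
    then show ?thesis by (simp add: abs_mult mult_ac)
  qed
qed

text \<open>The direction is a Perron eigenvector, for the smallest eigenvalue of \<open>A\<close>.\<close>

lemma z_matrix_not_psd_direction: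
  fixes A :: "real^'n^'n"
  assumes sym: "transpose A = A" and Z: "z_matrix A" and npsd: "\<not> positive_semidefinite A"
  obtains y where "\<And>i. 0 \<le> y $ i" "y \<noteq> 0" "\<And>i. 0 < y $ i \<Longrightarrow> (A *v y) $ i < 0"
proof -
  define f where "f = (\<lambda>x. x \<bullet> (A *v x))"
  have "continuous_on (sphere 0 1) f"
    unfolding f_def by (intro continuous_intros matrix_vector_mult_linear_continuous_on)
  moreover have "sphere 0 1 \<noteq> ({} :: (real^'n) set)" by simp
  ultimately obtain x where x: "x \<in> sphere 0 1" and min: "\<And>y. y \<in> sphere 0 1 \<Longrightarrow> f x \<le> f y"
    using continuous_attains_inf[OF compact_sphere, of 0 1 f] by blast
  have low: "f x * (y \<bullet> y) \<le> f y" for y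
  proof (cases "y = 0")
    case False
    then have "f x \<le> f ((1 / norm y) *\<^sub>R y)" by (intro min) simp
    also have "\<dots> = f y / (y \<bullet> y)"
      by (simp add: f_def matrix_vector_mult_scaleR power2_norm_eq_inner[symmetric] power2_eq_square)
    finally show ?thesis using False by (simp add: field_simps)
  qed (simp add: f_def)
  obtain x0 where "f x0 < 0" using sym npsd by (auto simp: positive_semidefinite_def f_def not_le)
  then have neg: "f x < 0"
    using low[of x0] inner_ge_zero[of x0] by (metis le_less_trans mult_nonneg_nonneg not_le)
  define a where "a = (\<chi> i. \<bar>x $ i\<bar>)"
  have aa: "a \<bullet> a = 1"
    using x by (simp add: a_def inner_vec_def norm_eq_1)
  have fa: "f a \<le> f x" using z_matrix_abs[OF Z, of x] by (simp add: f_def a_def)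
  \<comment> \<open>Subtracting the minimum of the form makes the matrix positive semidefinite with
    value 0 at \<open>a\<close>, so the eigenvector equation becomes a kernel statement.\<close>
  define A' where "A' = A - f x *\<^sub>R mat 1"
  have A'v: "A' *v z = A *v z - f x *\<^sub>R z" for z
    by (simp add: A'_def matrix_vector_mult_diff_rdistrib scaleR_matrix_vector_assoc[symmetric])
  have "positive_semidefinite A'"
    unfolding positive_semidefinite_def
  proof (intro conjI allI)
    show "transpose A' = A'"
      using sym by (simp add: A'_def transpose_def mat_def vec_eq_iff)
    show "0 \<le> z \<bullet> (A' *v z)" for z
      using low[of z] by (simp add: A'v inner_diff_right f_def)
  qed
  moreover have "a \<bullet> (A' *v a) = 0"
    using low[of a] fa aa by (simp add: A'v inner_diff_right f_def)
  ultimately have "A' *v a = 0" by (rule positive_semidefinite_kernel)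
  then have eig: "A *v a = f x *\<^sub>R a" by (simp add: A'v)
  show thesis
  proof (rule that[of a])
    show "0 \<le> a $ i" for i by (simp add: a_def)
    show "a \<noteq> 0" using aa by auto
    show "(A *v a) $ i < 0" if "0 < a $ i" for i
      using that neg by (simp add: eig mult_neg_pos)
  qed
qed

text \<open>Test \<open>A *v z\<close> against the negative part \<open>n\<close> of
  \<open>z\<close>. Here \<open>z + n\<close> is the positive part, which has no common support with
  \<open>n\<close>, so the off-diagonal signs give \<open>n \<bullet> (A *v n) \<le> 0\<close>;
  hence \<open>n\<close> is a null vector.\<close>

lemma z_matrix_psd_inverse_nonneg:
  fixes A :: "real^'n^'n"
  assumes Z: "z_matrix A" and psd: "positive_semidefinite A" and inj: "\<And>x. A *v x = 0 \<Longrightarrow> x = 0"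
    and z: "\<And>i. 0 \<le> (A *v z) $ i"
  shows "0 \<le> z $ i"
proof -
  define n where "n = (\<chi> i. max 0 (- z $ i))"
  have "0 \<le> n \<bullet> (A *v z)"
    unfolding inner_vec_def by (intro sum_nonneg) (auto simp: n_def z)
  also have "\<dots> \<le> n \<bullet> (A *v (- n))"
    unfolding quadratic_form_sum
  proof (intro sum_mono)
    fix i j
    have "n $ i * A $ i $ j * (z $ j + n $ j) \<le> 0"
    proof (cases "i = j")
      case True
      then show ?thesis by (auto simp: n_def max_def)
    next
      case False
      then have "n $ i * A $ i $ j \<le> 0"
        using Z by (intro mult_nonneg_nonpos) (auto simp: n_def z_matrix_def)
      then show ?thesis by (rule mult_nonpos_nonneg) (auto simp: n_def)
    qed
    then show "n $ i * A $ i $ j * z $ j \<le> n $ i * A $ i $ j * (- n) $ j" by (simp add: algebra_simps)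
  qed
  also have "\<dots> = - (n \<bullet> (A *v n))" by (simp add: quadratic_form_sum sum_negf)
  finally have "n \<bullet> (A *v n) = 0" using psd by (simp add: positive_semidefinite_def antisym)
  then have "n = 0" using positive_semidefinite_kernel[OF psd] inj by blast
  then have "n $ i = 0" by simp
  then show ?thesis by (simp add: n_def max_def split: if_splits)
qed

text \<open>At a zero of \<open>z\<close> the diagonal term vanishes and all others are nonpositive,
  so each single term bounds the row. This acts as a strong minimum principle: a zero of
  \<open>z\<close> next to a positive entry forces a negative row.\<close>

lemma z_matrix_row:
  fixes A :: "real^'n^'n"
  assumes Z: "z_matrix A" and z: "\<And>i. 0 \<le> z $ i" and i: "z $ i = 0"
  shows "(A *v z) $ i \<le> A $ i $ j * z $ j"
proof -
  have "(A *v z) $ i = (\<Sum>l\<in>UNIV. A $ i $ l * z $ l)" by (simp add: matrix_vector_mult_def)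
  also have "\<dots> = A $ i $ j * z $ j + (\<Sum>l\<in>UNIV - {j}. A $ i $ l * z $ l)"
    by (rule sum.remove) auto
  also have "(\<Sum>l\<in>UNIV - {j}. A $ i $ l * z $ l) \<le> 0"
  proof (rule sum_nonpos)
    fix l
    show "A $ i $ l * z $ l \<le> 0"
      using Z z[of l] i by (cases "l = i") (auto simp: z_matrix_def mult_nonpos_nonneg)
  qed
  finally show ?thesis by simp
qed

section \<open>The Jacobian of the constraint map and the matrix of condition (C)\<close>

definition dvolt :: "real^'n \<Rightarrow> 'n bus \<Rightarrow> real" where
  "dvolt y b = (case b of None \<Rightarrow> 0 | Some i \<Rightarrow> y $ i)"

lemma dvolt_simps [simp]: "dvolt y None = 0" "dvolt y (Some i) = y $ i"
  by (simp_all add: dvolt_def)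

lemma has_derivative_volt: "((\<lambda>v. volt v b) has_derivative (\<lambda>y. dvolt y b)) (at v)"
  by (cases b) (auto intro: bounded_linear.has_derivative[OF bounded_linear_vec_nth has_derivative_ident])

lemma has_derivative_vecI:
  fixes f :: "'a::real_normed_vector \<Rightarrow> real^'m"
  assumes "\<And>i. ((\<lambda>x. f x $ i) has_derivative (\<lambda>x. f' x $ i)) (at a)"
  shows "(f has_derivative f') (at a)"
  by (subst has_derivative_componentwise_within) (use assms in \<open>auto simp: Basis_vec_def inner_axis\<close>)

lemma outer_mult_vec: "outer x y *v z = (y \<bullet> z) *\<^sub>R x"
  by (simp add: outer_def matrix_vector_mult_def vec_eq_iff inner_vec_def sum_distrib_left
      mult_ac)

lemma matrix_vector_mult_sum_left: "(\<Sum>x\<in>S. A x) *v z = (\<Sum>x\<in>S. A x *v (z :: real^'n))"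
  by (induction S rule: infinite_finite_induct) (auto simp: matrix_vector_mult_add_rdistrib)

lemma e_bus_inner: "e_bus b \<bullet> y = dvolt y b"
  by (cases b) (auto simp: e_bus_def inner_axis' )

lemma e_bus_nth: "e_bus b $ i = (if b = Some i then 1 else 0)"
  by (cases b) (auto simp: e_bus_def axis_def)

lemma transpose_outer: "transpose (outer x x) = outer x x"
  by (simp add: transpose_def outer_def vec_eq_iff mult.commute)

context tree_network
begin

text \<open>On \<open>qmap_domain\<close> this is the nonnegative branch of \<open>c\<close> in the
  power flow equations. It involves no phases, so stability can be settled before phases are
  recovered.\<close>

definition cc :: "real^'n \<Rightarrow> real^'n \<Rightarrow> 'n bus \<Rightarrow> 'n bus \<Rightarrow> real" where
  "cc p v a b = sqrt (volt v a * volt v b - (flow E B p a b)\<^sup>2)"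

definition qderiv :: "real^'n \<Rightarrow> real^'n \<Rightarrow> real^'n \<Rightarrow> real^'n" where
  "qderiv p v y = (\<chi> i. \<Sum>k\<in>nbrs E (Some i). B (Some i) k *
    (y $ i - (v $ i * dvolt y k + y $ i * volt v k) / (2 * cc p v (Some i) k)))"

definition stability_matrix :: "real^'n \<Rightarrow> real^'n \<Rightarrow> real^'n^'n" where
  "stability_matrix p v =
    (\<Sum>i\<in>UNIV. (2 * Btot E B (Some i) * v $ i) *\<^sub>R outer (e_bus (Some i)) (e_bus (Some i)))
    - (\<Sum>(i, k)\<in>E. (B i k * volt v i * volt v k / cc p v i k) *\<^sub>R
        outer (e_bus i + e_bus k) (e_bus i + e_bus k))"

definition nondegenerate :: "real^'n \<Rightarrow> real^'n \<Rightarrow> bool" where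
  "nondegenerate p v \<longleftrightarrow> positive_vec v \<and> (\<forall>a. \<forall>b\<in>nbrs E a. 0 < cc p v a b)"

lemma cc_sym: "cc p v b a = cc p v a b"
  using flow_sq_sym[of p a b] by (simp add: cc_def mult.commute)

lemma has_derivative_qmap:
  assumes "nondegenerate p v"
  shows "(qmap E B p has_derivative qderiv p v) (at v)"
proof (rule has_derivative_vecI)
  fix i
  have sq: "((\<lambda>v. sqrt (volt v (Some i) * volt v k - (flow E B p (Some i) k)\<^sup>2)) has_derivative
      (\<lambda>y. (v $ i * dvolt y k + y $ i * volt v k) / (2 * cc p v (Some i) k))) (at v)"
    if k: "k \<in> nbrs E (Some i)" for k
  proof -
    have "0 < cc p v (Some i) k" using assms k by (auto simp: nondegenerate_def)
    then have pos: "0 < volt v (Some i) * volt v k - (flow E B p (Some i) k)\<^sup>2" by (simp add: cc_def)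
    have "((\<lambda>v. volt v (Some i) * volt v k) has_derivative
        (\<lambda>y. volt v (Some i) * dvolt y k + dvolt y (Some i) * volt v k)) (at v)"
      by (rule has_derivative_mult[OF has_derivative_volt has_derivative_volt])
    then have "((\<lambda>v. volt v (Some i) * volt v k - (flow E B p (Some i) k)\<^sup>2) has_derivative
        (\<lambda>y. volt v (Some i) * dvolt y k + dvolt y (Some i) * volt v k)) (at v)"
      using has_derivative_diff[OF _ has_derivative_const] by fastforce
    from has_derivative_real_sqrt[OF pos this]
    have "((\<lambda>v. sqrt (volt v (Some i) * volt v k - (flow E B p (Some i) k)\<^sup>2)) has_derivative
      (\<lambda>y. (volt v (Some i) * dvolt y k + dvolt y (Some i) * volt v k) *
        (inverse (cc p v (Some i) k) / 2))) (at v)" unfolding cc_def .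
    moreover have "(\<lambda>y. (volt v (Some i) * dvolt y k + dvolt y (Some i) * volt v k) *
        (inverse (cc p v (Some i) k) / 2)) =
        (\<lambda>y. (v $ i * dvolt y k + y $ i * volt v k) / (2 * cc p v (Some i) k))"
      by (rule ext) (simp add: field_simps)
    ultimately show ?thesis by (simp only:)
  qed
  have "((\<lambda>v. \<Sum>k\<in>nbrs E (Some i). B (Some i) k *
      (volt v (Some i) - sqrt (volt v (Some i) * volt v k - (flow E B p (Some i) k)\<^sup>2))) has_derivative
      (\<lambda>y. \<Sum>k\<in>nbrs E (Some i). B (Some i) k *
        (dvolt y (Some i) - (v $ i * dvolt y k + y $ i * volt v k) / (2 * cc p v (Some i) k)))) (at v)"
    by (intro has_derivative_sum has_derivative_mult_right has_derivative_diff has_derivative_volt sq)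
  then show "((\<lambda>v. qmap E B p v $ i) has_derivative (\<lambda>y. qderiv p v y $ i)) (at v)"
    by (simp add: qmap_nth qderiv_def)
qed

text \<open>The gradient inequality of a convex function, row by row. At \<open>v'\<close> radicands
  may vanish, so the inequality reaches points where \<open>qmap\<close> has no derivative.\<close>

lemma qmap_gradient:
  assumes v: "nondegenerate p v" and v': "qmap_domain E B p v'"
  shows "qmap E B p v $ i + qderiv p v (v' - v) $ i \<le> qmap E B p v' $ i"
proof -
  have "B (Some i) k * (v $ i - cc p v (Some i) k) + B (Some i) k *
      ((v' - v) $ i - (v $ i * dvolt (v' - v) k + (v' - v) $ i * volt v k) / (2 * cc p v (Some i) k)) \<le>
      B (Some i) k * (v' $ i - sqrt (v' $ i * volt v' k - (flow E B p (Some i) k)\<^sup>2))"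
    if k: "k \<in> nbrs E (Some i)" for k
  proof -
    have nn: "0 \<le> volt v b" "0 \<le> volt v' b" for b
      using v v' volt_pos by (auto simp: nondegenerate_def qmap_domain_def intro: less_imp_le)
    have c: "0 < cc p v (Some i) k" using v k by (auto simp: nondegenerate_def)
    have d: "dvolt (v' - v) k = volt v' k - volt v k" by (cases k) auto
    have "sqrt (v' $ i * volt v' k - (flow E B p (Some i) k)\<^sup>2) \<le> cc p v (Some i) k +
        (v $ i * (volt v' k - volt v k) + volt v k * (v' $ i - v $ i)) / (2 * cc p v (Some i) k)"
      using edge_gradient[OF nn(1)[of "Some i"] nn(1)[of k] nn(2)[of "Some i"] nn(2)[of k]
          domain_nbr[OF v' k], of "cc p v (Some i) k"] c
      by (simp add: cc_def)
    then have "B (Some i) k * (v $ i - cc p v (Some i) k + ((v' - v) $ i -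
        (v $ i * dvolt (v' - v) k + (v' - v) $ i * volt v k) / (2 * cc p v (Some i) k))) \<le>
        B (Some i) k * (v' $ i - sqrt (v' $ i * volt v' k - (flow E B p (Some i) k)\<^sup>2))"
      using weight_pos[OF k] by (intro mult_left_mono) (auto simp: d mult.commute)
    then show ?thesis by (simp only: distrib_left)
  qed
  then show ?thesis
    unfolding qmap_nth qderiv_def vec_lambda_beta sum.distrib[symmetric]
    by (intro sum_mono) (simp add: cc_def)
qed

text \<open>The Jacobian entry of a line carries the factor \<open>v $ i\<close>, and scaling column
  \<open>k\<close> by its voltage supplies the missing \<open>volt v k\<close>. This is the
  symmetrisation that links \<open>qderiv\<close> to condition (C).\<close>

lemma stability_matrix_mult:
  "stability_matrix p v *v y = 2 *\<^sub>R qderiv p v (\<chi> i. v $ i * y $ i)"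
proof -
  define z where "z = (\<chi> i. v $ i * y $ i)"
  define \<kappa> where "\<kappa> = (\<lambda>a b. B a b * volt v a * volt v b / cc p v a b)"
  have dz: "dvolt z b = volt v b * dvolt y b" for b by (cases b) (auto simp: z_def)
  have "(stability_matrix p v *v y) $ i = 2 * qderiv p v z $ i" for i
  proof -
    define F where "F = (\<lambda>a b. \<kappa> a b * (dvolt y a + dvolt y b) * e_bus a $ i)"
    have diag: "(\<Sum>j\<in>UNIV. ((2 * Btot E B (Some j) * v $ j) *\<^sub>R
        outer (e_bus (Some j)) (e_bus (Some j))) *v y) $ i = 2 * Btot E B (Some i) * z $ i"
      by (simp add: scaleR_matrix_vector_assoc[symmetric] outer_mult_vec e_bus_inner e_bus_nth z_def
          if_distrib[of "\<lambda>x. _ * x"] cong: if_cong)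
    have "(\<Sum>(a, b)\<in>E. (\<kappa> a b *\<^sub>R outer (e_bus a + e_bus b) (e_bus a + e_bus b)) *v y) $ i =
        (\<Sum>(a, b)\<in>E. F a b + F b a)"
      unfolding sum_component
    proof (rule sum.cong[OF refl], clarify)
      fix a b assume "(a, b) \<in> E"
      then have "B b a = B a b" using weight_sym[of b a] by (simp add: nbrs_iff)
      then have "\<kappa> b a = \<kappa> a b" by (simp add: \<kappa>_def cc_sym[of p v b a] mult_ac)
      then show "((\<kappa> a b *\<^sub>R outer (e_bus a + e_bus b) (e_bus a + e_bus b)) *v y) $ i = F a b + F b a"
        by (simp add: scaleR_matrix_vector_assoc[symmetric] outer_mult_vec inner_add_left e_bus_inner
            F_def algebra_simps)
    qed
    also have "\<dots> = (\<Sum>a\<in>UNIV. \<Sum>b\<in>nbrs E a. F a b)"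
      by (rule sum_nbrs_eq_sum_edges[symmetric])
    also have "\<dots> = (\<Sum>a\<in>UNIV. if a = Some i then \<Sum>b\<in>nbrs E (Some i). F (Some i) b else 0)"
      by (intro sum.cong) (auto simp: F_def e_bus_nth)
    also have "\<dots> = (\<Sum>k\<in>nbrs E (Some i). \<kappa> (Some i) k * (y $ i + dvolt y k))"
      by (simp add: F_def e_bus_nth)
    finally have off: "(\<Sum>(a, b)\<in>E. (\<kappa> a b *\<^sub>R outer (e_bus a + e_bus b) (e_bus a + e_bus b)) *v y) $ i =
        (\<Sum>k\<in>nbrs E (Some i). \<kappa> (Some i) k * (y $ i + dvolt y k))" .
    have "(stability_matrix p v *v y) $ i =
        2 * Btot E B (Some i) * z $ i - (\<Sum>k\<in>nbrs E (Some i). \<kappa> (Some i) k * (y $ i + dvolt y k))"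
      unfolding diag[symmetric] off[symmetric]
      by (simp add: stability_matrix_def matrix_vector_mult_diff_rdistrib matrix_vector_mult_sum_left
          split_def \<kappa>_def)
    also have "\<dots> = 2 * qderiv p v z $ i"
      unfolding qderiv_def vec_lambda_beta Btot_def sum_distrib_left sum_distrib_right
        sum_subtractf[symmetric]
    proof (rule sum.cong[OF refl])
      fix k
      have "v $ i * dvolt z k + z $ i * volt v k = v $ i * volt v k * (y $ i + dvolt y k)"
        unfolding dz by (simp add: z_def algebra_simps)
      then show "2 * B (Some i) k * z $ i - \<kappa> (Some i) k * (y $ i + dvolt y k) =
          2 * (B (Some i) k * (z $ i - (v $ i * dvolt z k + z $ i * volt v k) / (2 * cc p v (Some i) k)))"
        by (simp add: \<kappa>_def right_diff_distrib)
    qed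
    finally show ?thesis .
  qed
  then show ?thesis by (simp add: vec_eq_iff z_def)
qed

lemma stability_matrix_symmetric: "transpose (stability_matrix p v) = stability_matrix p v"
proof -
  have "linear (transpose :: real^'n^'n \<Rightarrow> real^'n^'n)"
    by (rule linearI) (simp_all add: transpose_def vec_eq_iff)
  then show ?thesis
    unfolding stability_matrix_def
    by (simp add: linear_diff linear_sum linear_scale transpose_outer split_def)
qed

lemma stability_matrix_off_diag:
  assumes "i \<noteq> j"
  shows "stability_matrix p v $ i $ j =
    (if Some j \<in> nbrs E (Some i)
     then - (B (Some i) (Some j) * v $ i * v $ j / cc p v (Some i) (Some j)) else 0)"
proof -
  let ?y = "axis j (1::real)"
  have dv: "dvolt (\<chi> l. v $ l * ?y $ l) k = (if k = Some j then v $ j else 0)" for k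
    by (cases k) (auto simp: axis_def)
  have "stability_matrix p v $ i $ j = (stability_matrix p v *v ?y) $ i"
    by (simp add: matrix_vector_mult_basis column_def)
  also have "\<dots> = 2 * qderiv p v (\<chi> l. v $ l * ?y $ l) $ i" by (simp add: stability_matrix_mult)
  also have "qderiv p v (\<chi> l. v $ l * ?y $ l) $ i = (\<Sum>k\<in>nbrs E (Some i). if k = Some j then
      - (B (Some i) (Some j) * v $ i * v $ j / (2 * cc p v (Some i) (Some j))) else 0)"
    unfolding qderiv_def vec_lambda_beta dv
    by (rule sum.cong[OF refl]) (use assms in \<open>auto simp: dv axis_def\<close>)
  finally show ?thesis by simp
qed

lemma stability_matrix_z:
  assumes "nondegenerate p v"
  shows "z_matrix (stability_matrix p v)"
  unfolding z_matrix_def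
proof (intro allI impI)
  fix i j :: 'n assume "i \<noteq> j"
  moreover have "0 < v $ i" "0 < v $ j" using assms by (auto simp: nondegenerate_def positive_vec_def)
  moreover have "0 < cc p v (Some i) (Some j)" "0 < B (Some i) (Some j)"
    if "Some j \<in> nbrs E (Some i)"
    using that assms weight_pos by (auto simp: nondegenerate_def)
  ultimately show "stability_matrix p v $ i $ j \<le> 0"
    by (cases "Some j \<in> nbrs E (Some i)") (simp_all add: stability_matrix_off_diag)
qed

section \<open>Stability and regularity of the greatest feasible point\<close>

lemma greatest_feasible_nondegenerate:
  assumes "greatest_feasible p q V"
  shows "nondegenerate p V"
  using assms greatest_feasible_radicand_pos[OF assms]
  by (auto simp: nondegenerate_def cc_def greatest_feasible_def R_feasible_def qmap_domain_def)

lemma greatest_feasible_stable: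
  assumes V: "greatest_feasible p q V"
  shows "positive_semidefinite (stability_matrix p V)"
proof (rule ccontr)
  assume "\<not> ?thesis"
  note nd = greatest_feasible_nondegenerate[OF V]
  from z_matrix_not_psd_direction[OF stability_matrix_symmetric stability_matrix_z[OF nd] \<open>\<not> _\<close>]
  obtain y where y: "\<And>i. 0 \<le> y $ i" "y \<noteq> 0" "\<And>i. 0 < y $ i \<Longrightarrow> (stability_matrix p V *v y) $ i < 0"
    by metis
  \<comment> \<open>Rescaling turns the direction for the symmetric matrix into a direction in
    voltages, by \<open>stability_matrix_mult\<close>.\<close>
  define d where "d = (\<chi> i. V $ i * y $ i)"
  have Vpos: "0 < V $ i" for i using nd by (simp add: nondegenerate_def positive_vec_def)
  have d: "0 \<le> d $ i" for i using y(1)[of i] Vpos[of i] by (simp add: d_def)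
  have ev: "\<forall>\<^sub>F t in at_right 0. 0 < d $ i \<longrightarrow> qmap E B p (V + t *\<^sub>R d) $ i < q $ i" for i
  proof (cases "0 < d $ i")
    case True
    then have "0 < y $ i" using y(1)[of i] by (simp add: d_def zero_less_mult_iff)
    then have neg: "qderiv p V d $ i < 0"
      using y(3)[of i] by (simp add: stability_matrix_mult d_def)
    have line: "((\<lambda>t. V + t *\<^sub>R d) has_derivative (\<lambda>t. t *\<^sub>R d)) (at 0)"
      by (auto intro!: derivative_eq_intros)
    have "((\<lambda>t. qmap E B p (V + t *\<^sub>R d)) has_derivative (\<lambda>t. qderiv p V (t *\<^sub>R d))) (at 0)"
      by (rule has_derivative_compose[OF line]) (simp add: has_derivative_qmap[OF nd])
    then have "((\<lambda>t. qmap E B p (V + t *\<^sub>R d) $ i) has_derivative (\<lambda>t. qderiv p V (t *\<^sub>R d) $ i)) (at 0)"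
      by (rule bounded_linear.has_derivative[OF bounded_linear_vec_nth])
    moreover have "qderiv p V (t *\<^sub>R d) $ i = qderiv p V d $ i * t" for t
      using linear_scale[OF has_derivative_linear[OF has_derivative_qmap[OF nd]], of t d]
      by simp
    ultimately have "((\<lambda>t. qmap E B p (V + t *\<^sub>R d) $ i) has_real_derivative qderiv p V d $ i) (at 0)"
      by (simp add: has_field_derivative_def)
    from DERIV_neg_dec_right[OF this neg] obtain e where "0 < e"
      "\<And>h. 0 < h \<Longrightarrow> h < e \<Longrightarrow> qmap E B p (V + h *\<^sub>R d) $ i < qmap E B p V $ i" by auto
    moreover have "qmap E B p V $ i = q $ i"
      using greatest_feasible_RPF[OF V] by (simp add: RPF_solution_def)
    ultimately show ?thesis by (auto simp: eventually_at_right_field)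
  qed simp
  have "\<forall>\<^sub>F t in at_right 0. (\<forall>i. 0 < d $ i \<longrightarrow> qmap E B p (V + t *\<^sub>R d) $ i < q $ i) \<and> (0::real) < t"
    by (intro eventually_conj eventually_all_finite ev) (simp add: eventually_at_right_less)
  then obtain t where t: "\<And>i. 0 < d $ i \<Longrightarrow> qmap E B p (V + t *\<^sub>R d) $ i < q $ i" "(0::real) < t"
    using eventually_happens'[OF trivial_limit_at_right_real] by blast
  have "V + t *\<^sub>R d = V"
  proof (rule greatest_feasible_no_raise[OF V])
    show "V \<le> V + t *\<^sub>R d" using d t(2) by (simp add: less_eq_vec_def)
    fix i assume "V $ i < (V + t *\<^sub>R d) $ i"
    then have "0 < d $ i" using t(2) by (simp add: zero_less_mult_iff)
    with t(1) show "qmap E B p (V + t *\<^sub>R d) $ i \<le> q $ i" by (simp add: less_imp_le)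
  qed
  then have "d = 0" using t(2) by simp
  then have "V $ i * y $ i = 0" for i by (simp add: d_def vec_eq_iff)
  then have "y $ i = 0" for i using Vpos[of i] by (metis mult_eq_0_iff less_irrefl)
  then show False using y(2) by (simp add: vec_eq_iff)
qed

text \<open>Column \<open>k\<close> of the sensitivity matrix, divided entrywise by
  \<open>v\<close>, solves a linear system with the stability matrix and right-hand side twice a
  basis vector. Inverse positivity gives nonnegativity; strict positivity spreads from
  \<open>k\<close> along lines that avoid the root, because a zero next to a positive entry would
  make a row negative.\<close>

lemma stable_imp_voltage_regular:
  assumes nd: "nondegenerate p v" and psd: "positive_semidefinite (stability_matrix p v)"
  shows "voltage_regular E B p v"
  unfolding voltage_regular_def
proof (intro impI allI)
  fix i k
  assume hs: "has_sensitivity E B p v"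
  define J where "J = jacobian (qmap E B p) (at v)"
  define S where "S = sensitivity E B p v"
  note Z = stability_matrix_z[OF nd]
  have vpos: "0 < v $ i" for i using nd by (simp add: nondegenerate_def positive_vec_def)
  have Jv: "J *v y = qderiv p v y" for y
    using has_derivative_unique[OF has_derivative_qmap[OF nd]] hs
    unfolding has_sensitivity_def jacobian_works J_def by metis
  have inv: "invertible J" using hs by (simp add: has_sensitivity_def J_def)
  then have JS: "J ** S = mat 1" and SJ: "S ** J = mat 1"
    unfolding S_def sensitivity_def J_def[symmetric] invertible_def matrix_inv_def
    by (metis (mono_tags, lifting) someI_ex)+
  have inj: "x = 0" if "stability_matrix p v *v x = 0" for x
  proof -
    have "J *v (\<chi> i. v $ i * x $ i) = 0" using that by (simp add: stability_matrix_mult Jv)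
    then have "(\<chi> i. v $ i * x $ i) = 0" using SJ matrix_left_invertible_ker by blast
    then have "v $ i * x $ i = 0" for i by (simp add: vec_eq_iff)
    then show ?thesis using vpos by (metis mult_eq_0_iff less_irrefl vec_eq_iff zero_index)
  qed
  define z where "z = (\<chi> i. S $ i $ k / v $ i)"
  have "(\<chi> i. v $ i * z $ i) = S *v axis k 1"
    using vpos by (simp add: z_def vec_eq_iff matrix_vector_mult_basis column_def less_imp_neq[symmetric])
  then have Qz: "stability_matrix p v *v z = 2 *\<^sub>R axis k 1"
    by (simp add: stability_matrix_mult Jv[symmetric] matrix_vector_mul_assoc JS)
  have z: "0 \<le> z $ i" for i
    by (rule z_matrix_psd_inverse_nonneg[OF Z psd inj]) (simp_all add: Qz axis_def)
  have strict: "0 < z $ j" if "(Some j, Some k) \<in> {(a, b) \<in> adjacency E. a \<noteq> None \<and> b \<noteq> None}\<^sup>*" for j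
    using that
  proof (induction "Some j :: 'n bus" arbitrary: j rule: converse_rtrancl_induct)
    case base
    show ?case
    proof (rule ccontr)
      assume "\<not> ?case"
      then have "z $ k = 0" using z[of k] by simp
      from z_matrix_row[OF Z z this, of k] this show False by (simp add: Qz)
    qed
  next
    case (step b)
    then obtain l where b: "b = Some l" by auto
    have nb: "Some l \<in> nbrs E (Some j)" using step.hyps b by (auto simp: nbrs_def)
    then have "j \<noteq> l" using nbrs_irrefl by auto
    have "0 < z $ l" using step b by simp
    moreover have "stability_matrix p v $ j $ l < 0"
      using nd nb \<open>j \<noteq> l\<close> vpos[of j] vpos[of l] weight_pos[OF nb]
      by (auto simp: stability_matrix_off_diag nondegenerate_def)
    ultimately have neg: "stability_matrix p v $ j $ l * z $ l < 0" by (simp add: mult_neg_pos)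
    show ?case
    proof (rule ccontr)
      assume "\<not> ?case"
      then have "z $ j = 0" using z[of j] by simp
      from z_matrix_row[OF Z z this, of l] neg have "(stability_matrix p v *v z) $ j < 0" by simp
      then show False by (simp add: Qz axis_def split: if_splits)
    qed
  qed
  have "S $ i $ k = v $ i * z $ i" using vpos[of i] by (simp add: z_def)
  then show "0 \<le> sensitivity E B p v $ i $ k \<and>
      (same_feeder E i k \<longrightarrow> 0 < sensitivity E B p v $ i $ k)"
    using z[of i] strict[of i] vpos[of i]
    by (auto simp: S_def[symmetric] same_feeder_def intro!: mult_pos_pos mult_nonneg_nonneg)
qed

text \<open>If the Jacobian is singular, it has a nonnegative left null vector (again by
  symmetrisation), and pairing it with the gradient inequality shows that \<open>q\<close> cannot be decreased.\<close>

lemma interior_has_sensitivity: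
  assumes V: "greatest_feasible p q V" and int: "(p, q) \<in> interior (feasible_set E B)"
  shows "has_sensitivity E B p V"
proof -
  note nd = greatest_feasible_nondegenerate[OF V] and psd = greatest_feasible_stable[OF V]
  define J where "J = jacobian (qmap E B p) (at V)"
  have Vpos: "0 < V $ i" for i using nd by (simp add: nondegenerate_def positive_vec_def)
  have diff: "qmap E B p differentiable (at V)" using has_derivative_qmap[OF nd] by (rule differentiableI)
  then have Jv: "J *v y = qderiv p V y" for y
    using has_derivative_unique[OF has_derivative_qmap[OF nd]]
    unfolding jacobian_works J_def by metis
  have scaled: "\<exists>x. y = (\<chi> i. V $ i * x $ i)" for y
    by (rule exI[of _ "\<chi> i. y $ i / V $ i"]) (use Vpos in \<open>simp add: vec_eq_iff less_imp_neq[symmetric]\<close>)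
  have "y = 0" if "J *v y = 0" for y
  proof (rule ccontr)
    assume "y \<noteq> 0"
    obtain x where x: "y = (\<chi> i. V $ i * x $ i)" using scaled by blast
    have "stability_matrix p V *v x = 0" using that by (simp add: stability_matrix_mult x Jv)
    \<comment> \<open>Absolute values keep the form at its minimum 0, so \<open>a\<close> is again a
      null vector, now nonnegative.\<close>
    define a where "a = (\<chi> i. \<bar>x $ i\<bar>)"
    have "a \<bullet> (stability_matrix p V *v a) \<le> 0"
      using z_matrix_abs[OF stability_matrix_z[OF nd], of x] \<open>stability_matrix p V *v x = 0\<close>
      by (simp add: a_def)
    then have "a \<bullet> (stability_matrix p V *v a) = 0"
      using psd by (simp add: positive_semidefinite_def antisym)
    then have Qa: "stability_matrix p V *v a = 0" by (rule positive_semidefinite_kernel[OF psd])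
    obtain e where e: "0 < e" "ball (p, q) e \<subseteq> feasible_set E B"
      using int mem_interior by blast
    \<comment> \<open>The vector \<open>1\<close> has all entries 1; lowering every component of
      \<open>q\<close> by this amount moves the data by exactly \<open>e / 2\<close>.\<close>
    define \<epsilon> where "\<epsilon> = e / 2 / norm (1 :: real^'n)"
    have n1: "0 < norm (1 :: real^'n)" by simp
    then have \<epsilon>: "0 < \<epsilon>" using e by (simp add: \<epsilon>_def)
    have "dist (p, q) (p, q - \<epsilon> *\<^sub>R 1) < e"
      using e n1 by (simp add: dist_Pair_Pair dist_norm \<epsilon>_def)
    then have "(p, q - \<epsilon> *\<^sub>R 1) \<in> feasible_set E B" using e(2) by auto
    then obtain v' where v': "R_feasible E B p (q - \<epsilon> *\<^sub>R 1) v'" by (auto simp: feasible_set_def)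
    obtain w where w: "v' - V = (\<chi> i. V $ i * w $ i)" using scaled by blast
    \<comment> \<open>Symmetry moves the matrix onto its null vector \<open>a\<close>, so
      \<open>a\<close> annihilates every derivative of \<open>qmap\<close> from the left.\<close>
    have "a \<bullet> (2 *\<^sub>R qderiv p V (v' - V)) = w \<bullet> (stability_matrix p V *v a)"
      unfolding w stability_matrix_mult[symmetric]
      by (rule symmetric_matrix_inner[OF stability_matrix_symmetric])
    then have "a \<bullet> qderiv p V (v' - V) = 0" by (simp add: Qa)
    then have zero: "(\<Sum>i\<in>UNIV. a $ i * qderiv p V (v' - V) $ i) = 0"
      by (simp add: inner_vec_def)
    have "a $ i * q $ i + a $ i * qderiv p V (v' - V) $ i \<le> a $ i * q $ i - a $ i * \<epsilon>" for i
    proof -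
      have "q $ i + qderiv p V (v' - V) $ i \<le> qmap E B p v' $ i"
        using qmap_gradient[OF nd, of v' i] v' greatest_feasible_RPF[OF V]
        by (simp add: R_feasible_def RPF_solution_def)
      also have "\<dots> \<le> q $ i - \<epsilon>" using v' by (auto simp: R_feasible_def)
      finally have "a $ i * (q $ i + qderiv p V (v' - V) $ i) \<le> a $ i * (q $ i - \<epsilon>)"
        by (intro mult_left_mono) (simp_all add: a_def)
      then show ?thesis by (simp add: algebra_simps)
    qed
    then have "(\<Sum>i\<in>UNIV. a $ i * q $ i + a $ i * qderiv p V (v' - V) $ i) \<le>
        (\<Sum>i\<in>UNIV. a $ i * q $ i - a $ i * \<epsilon>)" by (rule sum_mono)
    then have "(\<Sum>i\<in>UNIV. a $ i) * \<epsilon> \<le> 0"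
      by (simp add: sum.distrib sum_subtractf zero sum_distrib_right)
    then have "(\<Sum>i\<in>UNIV. a $ i) \<le> 0" using \<epsilon> by (simp add: mult_le_0_iff)
    moreover have "0 \<le> a $ i" for i by (simp add: a_def)
    ultimately have "a $ i = 0" for i
      by (metis (no_types, lifting) UNIV_I antisym finite sum_nonneg sum_nonneg_eq_0_iff)
    then have "y = 0" by (simp add: x a_def vec_eq_iff)
    with \<open>y \<noteq> 0\<close> show False ..
  qed
  then have "invertible J" unfolding invertible_left_inverse matrix_left_invertible_ker by blast
  with diff show ?thesis by (simp add: has_sensitivity_def J_def)
qed

end

section \<open>Phases and power flow solutions\<close>

lemma abs_le_imp_quotient_in_unit: "\<bar>s\<bar> \<le> r \<Longrightarrow> 0 < r \<Longrightarrow> -1 \<le> s / r \<and> s / r \<le> (1::real)"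
  by (auto simp: field_simps abs_le_iff)

context tree_network
begin

text \<open>The same dimension count as for flows: every non-root bus has one parent, so the
  differences along lines form a linear endomorphism. Its kernel is trivial because a vanishing
  difference passes the root value 0 down the tree.\<close>

lemma phases_ex1: "\<exists>!\<theta> :: real^('n bus). \<theta> $ None = 0 \<and> (\<forall>(a, b)\<in>E. \<theta> $ a - \<theta> $ b = d a b)"
proof (rule ex_ex1I)
  define par where "par = (\<lambda>i. SOME a. (a, Some i) \<in> E)"
  have par: "(par i, Some i) \<in> E" for i unfolding par_def by (rule someI_ex[OF parent_exists])
  \<comment> \<open>Here \<open>dvolt\<close> serves as extension of a vector by the reference phase
    0 at the root.\<close>
  define T where "T = (\<lambda>x :: real^'n. \<chi> i. dvolt x (par i) - x $ i)"
  have "linear T"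
  proof (rule linearI)
    fix x y :: "real^'n" and c :: real
    have "dvolt (x + y) b = dvolt x b + dvolt y b" "dvolt (c *\<^sub>R x) b = c * dvolt x b" for b
      by (cases b; simp)+
    then show "T (x + y) = T x + T y" "T (c *\<^sub>R x) = c *\<^sub>R T x"
      by (simp_all add: T_def vec_eq_iff algebra_simps)
  qed
  moreover have "inj T"
    unfolding linear_injective_0[OF \<open>linear T\<close>]
  proof (intro allI impI)
    fix x assume "T x = 0"
    then have eq: "dvolt x (par i) = x $ i" for i by (simp add: T_def vec_eq_iff)
    have "dvolt x b = 0" for b
    proof (induction b rule: tree_induct)
      case (edge a b)
      then obtain i where "b = Some i" using root_no_parent by (cases b) auto
      with edge.hyps have "par i = a" using par parent_unique by blast
      with edge.IH eq[of i] \<open>b = Some i\<close> show ?case by simp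
    qed simp
    from this[of "Some _"] show "x = 0" by (simp add: vec_eq_iff)
  qed
  ultimately have "surj T" by (rule linear_inj_imp_surj)
  then obtain x where x: "(\<chi> i. d (par i) (Some i)) = T x" by (metis surjD)
  show "\<exists>\<theta> :: real^('n bus). \<theta> $ None = 0 \<and> (\<forall>(a, b)\<in>E. \<theta> $ a - \<theta> $ b = d a b)"
  proof (intro exI[of _ "\<chi> b. dvolt x b"] conjI ballI, simp, clarify)
    fix a b assume ab: "(a, b) \<in> E"
    then obtain i where b: "b = Some i" using root_no_parent by (cases b) auto
    with ab have "a = par i" using par parent_unique by blast
    moreover have "d (par i) (Some i) = dvolt x (par i) - x $ i"
      using x by (simp add: T_def vec_eq_iff)
    ultimately show "(\<chi> b. dvolt x b) $ a - (\<chi> b. dvolt x b) $ b = d a b" using b by simp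
  qed
next
  fix \<theta> \<theta>' :: "real^('n bus)"
  assume 1: "\<theta> $ None = 0 \<and> (\<forall>(a, b)\<in>E. \<theta> $ a - \<theta> $ b = d a b)"
    and 2: "\<theta>' $ None = 0 \<and> (\<forall>(a, b)\<in>E. \<theta>' $ a - \<theta>' $ b = d a b)"
  have "\<theta> $ b = \<theta>' $ b" for b
  proof (induction b rule: tree_induct)
    case (edge a b)
    have "\<theta> $ a - \<theta> $ b = d a b" "\<theta>' $ a - \<theta>' $ b = d a b" using 1 2 edge.hyps by auto
    with edge.IH show ?case by simp
  qed (use 1 2 in simp)
  then show "\<theta> = \<theta>'" by (simp add: vec_eq_iff)
qed

lemma recovers_phases_ex1: "\<exists>!\<theta>. recovers_phases E B p v \<theta>"
  unfolding recovers_phases_def by (rule phases_ex1)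

lemma continuous_on_phases:
  fixes \<Theta> :: "'x::topological_space \<Rightarrow> real^('n bus)"
  assumes root: "\<And>x. x \<in> S \<Longrightarrow> \<Theta> x $ None = 0"
    and edge: "\<And>a b x. (a, b) \<in> E \<Longrightarrow> x \<in> S \<Longrightarrow> \<Theta> x $ a - \<Theta> x $ b = d a b x"
    and cont: "\<And>a b. (a, b) \<in> E \<Longrightarrow> continuous_on S (d a b)"
  shows "continuous_on S \<Theta>"
proof -
  have "continuous_on S (\<lambda>x. \<Theta> x $ b)" for b
  proof (induction b rule: tree_induct)
    case root
    have "continuous_on S (\<lambda>x. 0 :: real)" by simp
    then show ?case using assms(1) by (subst continuous_on_cong) auto
  next
    case (edge a b)
    have "continuous_on S (\<lambda>x. \<Theta> x $ a - d a b x)"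
      by (intro continuous_intros edge.IH cont edge.hyps)
    moreover have "\<Theta> x $ b = \<Theta> x $ a - d a b x" if "x \<in> S" for x
      using assms(2)[OF edge.hyps that] by simp
    ultimately show ?case by (subst continuous_on_cong) auto
  qed
  then have "continuous_on S (\<lambda>x. \<chi> b. \<Theta> x $ b)" by (rule continuous_on_vec_lambda)
  then show ?thesis by simp
qed

text \<open>Values of \<open>arcsin\<close> have nonnegative cosine, so the recovered phases select
  the branch \<open>cc\<close>. Reversed lines follow from the parity of sine and cosine.\<close>

lemma sin_cos_recovered_phases:
  assumes \<theta>: "recovers_phases E B p v \<theta>" and dom: "qmap_domain E B p v" and ab: "b \<in> nbrs E a"
  shows "sqrt (volt v a * volt v b) * sin (\<theta> $ a - \<theta> $ b) = flow E B p a b"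
    and "sqrt (volt v a * volt v b) * cos (\<theta> $ a - \<theta> $ b) = cc p v a b"
proof -
  have base: "sqrt (volt v a * volt v b) * sin (\<theta> $ a - \<theta> $ b) = flow E B p a b \<and>
      sqrt (volt v a * volt v b) * cos (\<theta> $ a - \<theta> $ b) = cc p v a b" if e: "(a, b) \<in> E" for a b
  proof -
    define r where "r = sqrt (volt v a * volt v b)"
    have "0 < volt v a" "0 < volt v b" using dom volt_pos by (auto simp: qmap_domain_def)
    then have r: "0 < r" and r2: "r\<^sup>2 = volt v a * volt v b" by (simp_all add: r_def)
    have dm: "(flow E B p a b)\<^sup>2 \<le> volt v a * volt v b"
      by (rule domain_nbr[OF dom]) (use e in \<open>simp add: nbrs_iff\<close>)
    then have le: "\<bar>flow E B p a b\<bar> \<le> r" by (metis r_def real_le_rsqrt power2_abs)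
    then have bd: "-1 \<le> flow E B p a b / r" "flow E B p a b / r \<le> 1"
      using abs_le_imp_quotient_in_unit[OF le r] by auto
    have th: "\<theta> $ a - \<theta> $ b = arcsin (flow E B p a b / r)"
      using \<theta> e by (auto simp: recovers_phases_def r_def)
    have "r * cos (arcsin (flow E B p a b / r)) = sqrt (r\<^sup>2) * sqrt (1 - (flow E B p a b / r)\<^sup>2)"
      using r by (simp add: cos_arcsin[OF bd])
    also have "\<dots> = sqrt (r\<^sup>2 - (flow E B p a b)\<^sup>2)"
      using r by (simp only: real_sqrt_mult[symmetric]) (simp add: power_divide field_simps)
    finally show ?thesis
      using r bd unfolding th r_def[symmetric] cc_def r2[symmetric] by (simp add: sin_arcsin)
  qed
  consider "(a, b) \<in> E" | "(b, a) \<in> E" using ab by (auto simp: nbrs_iff)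
  then have "sqrt (volt v a * volt v b) * sin (\<theta> $ a - \<theta> $ b) = flow E B p a b \<and>
      sqrt (volt v a * volt v b) * cos (\<theta> $ a - \<theta> $ b) = cc p v a b"
  proof cases
    case 2
    have "sin (\<theta> $ a - \<theta> $ b) = - sin (\<theta> $ b - \<theta> $ a)" "cos (\<theta> $ a - \<theta> $ b) = cos (\<theta> $ b - \<theta> $ a)"
      using sin_minus[of "\<theta> $ b - \<theta> $ a"] cos_minus[of "\<theta> $ b - \<theta> $ a"] by simp_all
    with base[OF 2] show ?thesis
      using flow_antisym[of p b a] cc_sym[of p v a b] by (simp add: mult.commute)
  qed (rule base)
  then show "sqrt (volt v a * volt v b) * sin (\<theta> $ a - \<theta> $ b) = flow E B p a b"
    and "sqrt (volt v a * volt v b) * cos (\<theta> $ a - \<theta> $ b) = cc p v a b" by auto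
qed

text \<open>Whatever the sign of \<open>c\<close>, replacing it by the nonnegative root of its
  square only lowers the left-hand side of each balance equation. Hence the power flow equations
  imply the constraints of (R).\<close>

lemma power_flow_feasible:
  assumes pos: "positive_vec v"
    and sq: "\<And>a b. b \<in> nbrs E a \<Longrightarrow> (flow E B p a b)\<^sup>2 + (c a b)\<^sup>2 = volt v a * volt v b"
    and net: "\<And>i. Btot E B (Some i) * v $ i - (\<Sum>k\<in>nbrs E (Some i). B (Some i) k * c (Some i) k) = q $ i"
  shows "R_feasible E B p q v"
proof -
  have "qmap E B p v $ i \<le> q $ i" for i
  proof -
    have "c (Some i) k \<le> sqrt (v $ i * volt v k - (flow E B p (Some i) k)\<^sup>2)"
      if "k \<in> nbrs E (Some i)" for k
      using sq[OF that] by (intro real_le_rsqrt) simp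
    then have "(\<Sum>k\<in>nbrs E (Some i). B (Some i) k * c (Some i) k) \<le>
        (\<Sum>k\<in>nbrs E (Some i). B (Some i) k * sqrt (v $ i * volt v k - (flow E B p (Some i) k)\<^sup>2))"
      by (intro sum_mono mult_left_mono) (auto intro: less_imp_le weight_pos)
    with net[of i] show ?thesis by (simp add: qmap_def)
  qed
  moreover have "(flow E B p a b)\<^sup>2 \<le> volt v a * volt v b" if "(a, b) \<in> E" for a b
  proof -
    have "(flow E B p a b)\<^sup>2 + (c a b)\<^sup>2 = volt v a * volt v b"
      by (rule sq) (use that in \<open>simp add: nbrs_iff\<close>)
    with zero_le_power2[of "c a b"] show ?thesis by linarith
  qed
  ultimately show ?thesis using pos by (auto simp: R_feasible_def qmap_domain_def)
qed

lemma PF_solution_feasible: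
  assumes "PF_solution E B p q v c"
  shows "R_feasible E B p q v"
proof (rule power_flow_feasible)
  fix a b assume "b \<in> nbrs E a"
  then consider "(a, b) \<in> E" | "(b, a) \<in> E" by (auto simp: nbrs_iff)
  then show "(flow E B p a b)\<^sup>2 + (c a b)\<^sup>2 = volt v a * volt v b"
  proof cases
    case 2
    with assms have "(flow E B p b a)\<^sup>2 + (c b a)\<^sup>2 = volt v b * volt v a" "c b a = c a b"
      by (auto simp: PF_solution_def)
    then show ?thesis using flow_sq_sym[of p a b] by (simp add: mult.commute)
  qed (use assms in \<open>auto simp: PF_solution_def\<close>)
qed (use assms in \<open>auto simp: PF_solution_def\<close>)

lemma polar_solution_flow:
  assumes "PF_polar_solution E B p q v \<theta>" and ab: "b \<in> nbrs E a"
  shows "flow E B p a b = sqrt (volt v a * volt v b) * sin (\<theta> $ a - \<theta> $ b)"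
proof -
  define s where "s = (\<lambda>a b. if b \<in> nbrs E a then sqrt (volt v a * volt v b) * sin (\<theta> $ a - \<theta> $ b) else 0)"
  have "is_flow E B p s"
  proof (rule is_flowI)
    fix a b
    show "s b a = - s a b"
      using nbrs_sym[of a b] sin_minus[of "\<theta> $ a - \<theta> $ b"] by (simp add: s_def mult.commute)
  qed (use assms in \<open>auto simp: s_def PF_polar_solution_def\<close>)
  then have "flow E B p = s" by (rule flow_eqI)
  with ab show ?thesis by (simp add: s_def)
qed

lemma polar_solution_sq:
  assumes "PF_polar_solution E B p q v \<theta>" and ab: "b \<in> nbrs E a"
  shows "(flow E B p a b)\<^sup>2 + (c_polar v \<theta> a b)\<^sup>2 = volt v a * volt v b"
proof -
  have "0 < volt v a" "0 < volt v b" using assms volt_pos by (auto simp: PF_polar_solution_def)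
  then have "(sqrt (volt v a * volt v b))\<^sup>2 = volt v a * volt v b" by simp
  moreover have "(flow E B p a b)\<^sup>2 + (c_polar v \<theta> a b)\<^sup>2 = (sqrt (volt v a * volt v b))\<^sup>2 *
      ((sin (\<theta> $ a - \<theta> $ b))\<^sup>2 + (cos (\<theta> $ a - \<theta> $ b))\<^sup>2)"
    unfolding polar_solution_flow[OF assms] c_polar_def power_mult_distrib distrib_left ..
  ultimately show ?thesis by (simp only: sin_cos_squared_add mult_1_right)
qed

lemma polar_solution_feasible:
  assumes "PF_polar_solution E B p q v \<theta>"
  shows "R_feasible E B p q v"
proof (rule power_flow_feasible[where c = "c_polar v \<theta>"])
  show "(flow E B p a b)\<^sup>2 + (c_polar v \<theta> a b)\<^sup>2 = volt v a * volt v b" if "b \<in> nbrs E a" for a b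
    by (rule polar_solution_sq[OF assms that])
qed (use assms in \<open>auto simp: PF_polar_solution_def c_polar_def\<close>)

lemma recovered_phases_polar_solution:
  assumes RPF: "RPF_solution E B p q v" and \<theta>: "recovers_phases E B p v \<theta>"
  shows "PF_polar_solution E B p q v \<theta>"
  unfolding PF_polar_solution_def
proof (intro conjI allI)
  have dom: "qmap_domain E B p v" using RPF by (simp add: RPF_solution_def)
  show "positive_vec v" using dom by (simp add: qmap_domain_def)
  show "\<theta> $ None = 0" using \<theta> by (simp add: recovers_phases_def)
  fix i
  note sc = sin_cos_recovered_phases[OF \<theta> dom, of _ "Some i", simplified]
  show "(\<Sum>k\<in>nbrs E (Some i). B (Some i) k * (sqrt (v $ i * volt v k) * sin (\<theta> $ Some i - \<theta> $ k))) = p $ i"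
    using is_flow_net[OF is_flow_flow, of i p] by (simp add: sc)
  show "Btot E B (Some i) * v $ i - (\<Sum>k\<in>nbrs E (Some i).
      B (Some i) k * (sqrt (v $ i * volt v k) * cos (\<theta> $ Some i - \<theta> $ k))) = q $ i"
    using RPF by (simp add: sc RPF_solution_def qmap_def cc_def)
qed

lemma condition_C_recovered_phases:
  assumes \<theta>: "recovers_phases E B p v \<theta>" and dom: "qmap_domain E B p v"
    and nd: "nondegenerate p v" and psd: "positive_semidefinite (stability_matrix p v)"
  shows "condition_C E B v \<theta>"
proof -
  have c: "c_polar v \<theta> a b = cc p v a b" if "(a, b) \<in> E" for a b
    using sin_cos_recovered_phases(2)[OF \<theta> dom, of b a] that by (simp add: c_polar_def nbrs_iff)
  have "(\<Sum>(i, k)\<in>E. (B i k * volt v i * volt v k / c_polar v \<theta> i k) *\<^sub>R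
        outer (e_bus i + e_bus k) (e_bus i + e_bus k)) =
      (\<Sum>(i, k)\<in>E. (B i k * volt v i * volt v k / cc p v i k) *\<^sub>R
        outer (e_bus i + e_bus k) (e_bus i + e_bus k))"
    by (rule sum.cong) (auto simp: c)
  with psd have "positive_semidefinite
      ((\<Sum>i\<in>UNIV. (2 * Btot E B (Some i) * v $ i) *\<^sub>R outer (e_bus (Some i)) (e_bus (Some i)))
        - (\<Sum>(i, k)\<in>E. (B i k * volt v i * volt v k / c_polar v \<theta> i k) *\<^sub>R
             outer (e_bus i + e_bus k) (e_bus i + e_bus k)))"
    by (simp only: stability_matrix_def)
  moreover have "\<forall>(a, b)\<in>E. 0 < c_polar v \<theta> a b"
    using nd by (auto simp: c nondegenerate_def nbrs_iff)
  ultimately show ?thesis by (simp add: condition_C_def)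
qed

text \<open>A power flow solution is feasible and so lies below \<open>V\<close>, while
  \<open>V\<close> itself solves (RPF) and so lies below any high-voltage solution. With equal
  voltages the flows fix the sines and the sign condition fixes the cosines; line differences then
  agree modulo full turns, and summing from the root transfers this to the phases.\<close>

lemma high_voltage_solution_unique:
  assumes V: "greatest_feasible p q V" and \<theta>: "recovers_phases E B p V \<theta>"
    and sol: "PF_polar_solution E B p q v' \<theta>'" and high: "high_voltage E B p q v'"
    and c_pos: "\<And>a b. (a, b) \<in> E \<Longrightarrow> 0 < c_polar v' \<theta>' a b"
  shows "v' = V \<and> same_phases \<theta> \<theta>'"
proof -
  have RPF: "RPF_solution E B p q V" by (rule greatest_feasible_RPF[OF V])
  then have dom: "qmap_domain E B p V" by (simp add: RPF_solution_def)
  have "v' \<le> V" using V polar_solution_feasible[OF sol] by (simp add: greatest_feasible_def)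
  moreover have "V \<le> v'" using high RPF by (simp add: high_voltage_def less_eq_vec_def)
  ultimately have v': "v' = V" by (simp add: less_eq_vec_def vec_eq_iff order_antisym)
  have diff: "\<exists>m::int. \<theta>' $ a - \<theta>' $ b = \<theta> $ a - \<theta> $ b + 2 * pi * m" if e: "(a, b) \<in> E" for a b
  proof -
    have nb: "b \<in> nbrs E a" using e by (simp add: nbrs_iff)
    define r where "r = sqrt (volt V a * volt V b)"
    have "0 < volt V a" "0 < volt V b" using dom volt_pos by (auto simp: qmap_domain_def)
    then have r: "r \<noteq> 0" by (simp add: r_def)
    have "r * sin (\<theta>' $ a - \<theta>' $ b) = r * sin (\<theta> $ a - \<theta> $ b)"
      using polar_solution_flow[OF sol nb] sin_cos_recovered_phases(1)[OF \<theta> dom nb]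
      unfolding r_def v' by metis
    moreover have "c_polar v' \<theta>' a b = cc p V a b"
    proof -
      have "volt V a * volt V b - (flow E B p a b)\<^sup>2 = (c_polar v' \<theta>' a b)\<^sup>2"
        using polar_solution_sq[OF sol nb] by (simp add: v')
      then show ?thesis using c_pos[OF e] by (simp add: cc_def)
    qed
    then have "r * cos (\<theta>' $ a - \<theta>' $ b) = r * cos (\<theta> $ a - \<theta> $ b)"
      using sin_cos_recovered_phases(2)[OF \<theta> dom nb] by (simp add: r_def c_polar_def v')
    ultimately have "sin (\<theta>' $ a - \<theta>' $ b) = sin (\<theta> $ a - \<theta> $ b) \<and>
        cos (\<theta>' $ a - \<theta>' $ b) = cos (\<theta> $ a - \<theta> $ b)" using r by simp
    then show ?thesis by (simp only: sin_cos_eq_iff)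
  qed
  have "\<exists>m::int. \<theta>' $ b = \<theta> $ b + 2 * pi * of_int m" for b
  proof (induction b rule: tree_induct)
    case root
    show ?case
      using sol \<theta> by (intro exI[of _ 0]) (simp add: PF_polar_solution_def recovers_phases_def)
  next
    case (edge a b)
    then obtain m m' :: int where "\<theta>' $ a = \<theta> $ a + 2 * pi * m"
      "\<theta>' $ a - \<theta>' $ b = \<theta> $ a - \<theta> $ b + 2 * pi * m'" using diff by blast
    then have "\<theta>' $ b = \<theta> $ b + 2 * pi * of_int (m - m')" by (simp add: algebra_simps)
    then show ?case by blast
  qed
  then show ?thesis using v' by (simp add: same_phases_def)
qed

end

theorem mainTheorem2:
  fixes E :: "('n::finite bus \<times> 'n bus) set"
    and B :: "'n bus \<Rightarrow> 'n bus \<Rightarrow> real"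
    and w :: "real^'n"
  assumes tree: "rooted_tree E"
    and weights: "line_weights E B"
    and w_pos: "\<forall>i. 0 < w $ i"
  shows
    "((\<forall>p. \<exists>!s. is_flow E B p s) \<and>
      (\<forall>(p, q) \<in> feasible_set E B.
         (\<exists>!v. R_optimal E B w p q v) \<and>
         (\<exists>!\<theta>. recovers_phases E B p (v_opt E B w p q) \<theta>)))
     \<and>
     (convex (feasible_set E B) \<and>
      continuous_on (feasible_set E B) (\<lambda>(p, q). (v_opt E B w p q, theta_opt E B w p q)))
     \<and>
     (\<forall>p q. (p, q) \<notin> feasible_set E B \<longrightarrow>
        (\<nexists>v c. PF_solution E B p q v c) \<and> (\<nexists>v \<theta>. PF_polar_solution E B p q v \<theta>))
     \<and>
     (\<forall>(p, q) \<in> feasible_set E B.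
        (let v = v_opt E B w p q; \<theta> = theta_opt E B w p q in
           PF_polar_solution E B p q v \<theta> \<and>
           high_voltage E B p q v \<and>
           condition_C E B v \<theta> \<and>
           voltage_regular E B p v \<and>
           ((p, q) \<in> interior (feasible_set E B) \<longrightarrow> has_sensitivity E B p v) \<and>
           (\<forall>v' \<theta>'. PF_polar_solution E B p q v' \<theta>' \<and>
                    high_voltage E B p q v' \<and>
                    condition_C E B v' \<theta>' \<and>
                    voltage_regular E B p v'
               \<longrightarrow> v' = v \<and> same_phases \<theta> \<theta>')))"
proof -
  interpret tree_network E B by unfold_locales (fact tree weights)+
  let ?S = "feasible_set E B"
  let ?V = "v_opt E B w" and ?\<Theta> = "theta_opt E B w"
  have V: "greatest_feasible p q (?V p q)" if pq: "(p, q) \<in> ?S" for p q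
  proof -
    from pq obtain v where "R_feasible E B p q v" by (auto simp: feasible_set_def)
    from greatest_feasible_exists[OF this] obtain V where "greatest_feasible p q V" ..
    with v_opt_eq[OF this w_pos] show ?thesis by simp
  qed
  have opt: "\<exists>!v. R_optimal E B w p q v" if "(p, q) \<in> ?S" for p q
    using R_optimal_iff[OF V[OF that] w_pos] by simp
  have \<Theta>: "recovers_phases E B p (?V p q) (?\<Theta> p q)" for p q
    unfolding theta_opt_def by (rule theI'[OF recovers_phases_ex1])
  have RPF: "RPF_solution E B p q (?V p q)" if "(p, q) \<in> ?S" for p q
    by (rule greatest_feasible_RPF[OF V[OF that]])
  have dom: "qmap_domain E B p (?V p q)" if "(p, q) \<in> ?S" for p q
    using RPF[OF that] by (simp add: RPF_solution_def)
  have cont_V: "continuous_on ?S (\<lambda>(p, q). ?V p q)"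
    by (rule continuous_on_greatest_feasible) (rule V)
  have cont_\<Theta>: "continuous_on ?S (\<lambda>(p, q). ?\<Theta> p q)"
  proof (rule continuous_on_phases[where d = "\<lambda>a b (p, q). arcsin (flow E B p a b / sqrt (volt (?V p q) a * volt (?V p q) b))"])
    fix a b x assume "(a, b) \<in> E" "x \<in> ?S"
    then show "(case x of (p, q) \<Rightarrow> ?\<Theta> p q) $ a - (case x of (p, q) \<Rightarrow> ?\<Theta> p q) $ b =
        (case x of (p, q) \<Rightarrow> arcsin (flow E B p a b / sqrt (volt (?V p q) a * volt (?V p q) b)))"
      using \<Theta>[of "fst x" "snd x"] by (auto simp: recovers_phases_def split_def)
  next
    fix a b assume e: "(a, b) \<in> E"
    have volt: "continuous_on ?S (\<lambda>x. volt (?V (fst x) (snd x)) c)" for c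
      using cont_V unfolding continuous_on_def split_def by (auto intro: tendsto_volt)
    have fl: "continuous_on ?S (\<lambda>x. flow E B (fst x) a b)"
      unfolding continuous_on_def by (auto intro!: tendsto_flow tendsto_intros)
    have vp: "0 < volt (?V p q) c" if "(p, q) \<in> ?S" for p q c
      using dom[OF that] volt_pos by (auto simp: qmap_domain_def)
    have "\<bar>flow E B p a b\<bar> \<le> sqrt (volt (?V p q) a * volt (?V p q) b)" if "(p, q) \<in> ?S" for p q
      using domain_nbr[OF dom[OF that], of b a] e by (intro real_le_rsqrt) (simp add: nbrs_iff)
    \<comment> \<open>Continuity of \<open>arcsin\<close> on the closed interval is used, so
      nonnegative radicands suffice.\<close>
    then have bd: "-1 \<le> flow E B p a b / sqrt (volt (?V p q) a * volt (?V p q) b) \<and>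
        flow E B p a b / sqrt (volt (?V p q) a * volt (?V p q) b) \<le> 1" if "(p, q) \<in> ?S" for p q
      using vp[OF that] that by (intro abs_le_imp_quotient_in_unit) auto
    have "continuous_on ?S (\<lambda>x. arcsin (flow E B (fst x) a b /
        sqrt (volt (?V (fst x) (snd x)) a * volt (?V (fst x) (snd x)) b)))"
    proof (intro continuous_on_arcsin continuous_on_divide fl continuous_on_real_sqrt
        continuous_on_mult volt ballI)
      fix x assume "x \<in> ?S"
      then show "sqrt (volt (?V (fst x) (snd x)) a * volt (?V (fst x) (snd x)) b) \<noteq> 0"
        using vp[of "fst x" "snd x" a] vp[of "fst x" "snd x" b] by simp
    qed (use bd in force)
    then show "continuous_on ?S (\<lambda>(p, q). arcsin (flow E B p a b / sqrt (volt (?V p q) a * volt (?V p q) b)))"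
      by (simp add: split_def)
  qed (use \<Theta> in \<open>auto simp: recovers_phases_def\<close>)
  have cont: "continuous_on ?S (\<lambda>(p, q). (?V p q, ?\<Theta> p q))"
    using continuous_on_Pair[OF cont_V cont_\<Theta>] by (simp add: split_def)
  have none: "(\<nexists>v c. PF_solution E B p q v c) \<and> (\<nexists>v \<theta>. PF_polar_solution E B p q v \<theta>)"
    if "(p, q) \<notin> ?S" for p q
    using that PF_solution_feasible[of p q] polar_solution_feasible[of p q]
    unfolding feasible_set_def by blast
  have sol: "PF_polar_solution E B p q (?V p q) (?\<Theta> p q) \<and> high_voltage E B p q (?V p q) \<and>
      condition_C E B (?V p q) (?\<Theta> p q) \<and> voltage_regular E B p (?V p q) \<and>
      ((p, q) \<in> interior ?S \<longrightarrow> has_sensitivity E B p (?V p q)) \<and>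
      (\<forall>v' \<theta>'. PF_polar_solution E B p q v' \<theta>' \<and> high_voltage E B p q v' \<and>
        condition_C E B v' \<theta>' \<and> voltage_regular E B p v' \<longrightarrow> v' = ?V p q \<and> same_phases (?\<Theta> p q) \<theta>')"
    if pq: "(p, q) \<in> ?S" for p q
  proof (intro conjI impI allI)
    note nd = greatest_feasible_nondegenerate[OF V[OF pq]]
      and psd = greatest_feasible_stable[OF V[OF pq]]
    show "PF_polar_solution E B p q (?V p q) (?\<Theta> p q)"
      by (rule recovered_phases_polar_solution[OF RPF[OF pq] \<Theta>])
    show "high_voltage E B p q (?V p q)"
      using V[OF pq]
      by (auto simp: high_voltage_def greatest_feasible_def RPF_solution_def R_feasible_def less_eq_vec_def)
    show "condition_C E B (?V p q) (?\<Theta> p q)"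
      by (rule condition_C_recovered_phases[OF \<Theta> dom[OF pq] nd psd])
    show "voltage_regular E B p (?V p q)" by (rule stable_imp_voltage_regular[OF nd psd])
    show "has_sensitivity E B p (?V p q)" if "(p, q) \<in> interior ?S"
      by (rule interior_has_sensitivity[OF V[OF pq] that])
    fix v' \<theta>'
    assume "PF_polar_solution E B p q v' \<theta>' \<and> high_voltage E B p q v' \<and>
      condition_C E B v' \<theta>' \<and> voltage_regular E B p v'"
    then have "v' = ?V p q \<and> same_phases (?\<Theta> p q) \<theta>'"
      by (intro high_voltage_solution_unique[OF V[OF pq] \<Theta>]) (auto simp: condition_C_def)
    then show "v' = ?V p q" "same_phases (?\<Theta> p q) \<theta>'" by auto
  qed
  show ?thesis
    unfolding Let_def
    using is_flow_ex1 opt recovers_phases_ex1 convex_feasible_set cont none sol by blast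
qed

end
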